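(* Let $\ell\ge2$ be an integer, $W=S_n\ltimes(\mathbb Z/\ell\mathbb Z)^n$, and let $q\in\mathbb Z$ satisfy $1\le q\le\ell-1$. Suppose that $\nu=m+\frac{\ell-q+s}{\ell}$, $c_{q-s}=0$ and $c_{-s}=\frac s\ell$ for some $m,s\in\mathbb Z_{\ge0}$. Then the formulae $$f_j=\prod_{i=1}^nx_i^{\ell\nu}\ \mathrm{Res}_{z=0}\ z^{-\ell m-1}\prod_{i=1}^n\Big(1-\frac{z^\ell}{x_i^\ell}\Big)^{\nu}\,\frac{x_j^q\,dz}{x_j^\ell-z^\ell},\qquad j=1,\ldots,n$$ (where it is assumed in the formula that $x_i\ne0$ for all $i$), define singular polynomials, that is $\nabla_if_j=0$ for any $i,j=1,\ldots,n$. These polynomials are homogeneous of degree $(n-1)(m\ell+\ell-q)+ns$ and they span an irreducible $n$-dimensional representation of $W$.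
   Context: The complex reflection group $W=S_n\ltimes(\mathbb Z/\ell\mathbb Z)^n$ acts on $\mathbb C^n$ (standard basis $e_1,\ldots,e_n$, coordinates $x_1,\ldots,x_n$) and is generated by the reflections $\sigma_{ij}^{(a)}$ and $s_i$ given by $\sigma_{ij}^{(a)}e_i=\omega^{-a}e_j$, $\sigma_{ij}^{(a)}e_j=\omega^ae_i$, $\sigma_{ij}^{(a)}e_k=e_k$, and $s_ie_i=\omega e_i$, $s_ie_k=e_k$, where $\omega=e^{2\pi\sqrt{-1}/\ell}$, $i,j,k\in\{1,\ldots,n\}$ are pairwise distinct and $a=0,\ldots,\ell-1$. The group acts on functions by $(wf)(x)=f(w^{-1}x)$. The Dunkl operators, depending on parameters $\nu,c_1,\ldots,c_{\ell-1}\in\mathbb C$, are $$\nabla_i=\partial_{x_i}-\nu\sum_{a=0}^{\ell-1}\sum_{j\ne i}\frac1{x_i-\omega^ax_j}\big(1-\sigma_{ij}^{(a)}\big)-\sum_{b=1}^{\ell-1}c_b\sum_{a=0}^{\ell-1}\frac{\omega^{-ab}}{x_i}s_i^a.$$ Indices of $c$ are extended to all integers by $c_0=0$ and $c_{a\ell+b}=c_b$ for $a\in\mathbb Z$, $b=0,1,\ldots,\ell-1$. In the residue, $(1-z^\ell/x_i^\ell)^\nu$ denotes the binomial power series in $z$ equal to $1$ at $z=0$, and $\mathrm{Res}_{z=0}$ takes the coefficient of $z^{-1}$. *)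

theory Defs
  imports
    "HOL-Analysis.Analysis"
    "HOL-Library.Function_Algebras"
    "HOL-Computational_Algebra.Formal_Laurent_Series"
begin

section \<open>The group and its action on functions\<close>

definition omega :: "nat \<Rightarrow> complex" where
  "omega l = exp (2 * of_real pi * \<i> / of_nat l)"

text \<open>
  Linear maps are written in coordinates; the lemmas \<open>sigma_refl_axis\<close> and \<open>rot_axis\<close> below
  recover the description on the standard basis.  The map \<open>sigma_refl l i j a\<close> is only
  meaningful for \<open>i \<noteq> j\<close>.
\<close>

definition sigma_refl :: "nat \<Rightarrow> 'n::finite \<Rightarrow> 'n \<Rightarrow> nat \<Rightarrow> complex^'n \<Rightarrow> complex^'n" where
  "sigma_refl l i j a x =
     (\<chi> k. if k = i then omega l ^ a * x $ j
           else if k = j then omega l powi (- int a) * x $ i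
           else x $ k)"

definition rot :: "nat \<Rightarrow> 'n::finite \<Rightarrow> complex^'n \<Rightarrow> complex^'n" where
  "rot l i x = (\<chi> k. if k = i then omega l * x $ i else x $ k)"

lemma sigma_refl_axis:
  assumes "i \<noteq> j"
  shows "sigma_refl l i j a (axis i 1) = omega l powi (- int a) *s axis j 1"
    and "sigma_refl l i j a (axis j 1) = omega l ^ a *s axis i 1"
    and "k \<noteq> i \<Longrightarrow> k \<noteq> j \<Longrightarrow> sigma_refl l i j a (axis k 1) = axis k 1"
  using assms by (auto simp: sigma_refl_def axis_def vec_eq_iff)

lemma rot_axis:
  shows "rot l i (axis i 1) = omega l *s axis i 1"
    and "k \<noteq> i \<Longrightarrow> rot l i (axis k 1) = axis k 1"
  by (auto simp: rot_def axis_def vec_eq_iff)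

text \<open>
  The group generated by the reflections.  They have finite order, so closing under
  composition suffices; see \<open>refl_group_eq\<close> below.
\<close>

inductive_set refl_group :: "nat \<Rightarrow> (complex^'n::finite \<Rightarrow> complex^'n) set" for l :: nat where
  id: "id \<in> refl_group l"
| sigma: "w \<in> refl_group l \<Longrightarrow> i \<noteq> j \<Longrightarrow> a < l \<Longrightarrow> sigma_refl l i j a \<circ> w \<in> refl_group l"
| rot: "w \<in> refl_group l \<Longrightarrow> rot l i \<circ> w \<in> refl_group l"

text \<open>
  The element of the semidirect product of the symmetric group and the \<open>l\<close>-th roots of
  unity sending the basis vector \<open>e\<^sub>k\<close> to \<open>\<omega>\<close> to the power \<open>a (p k)\<close> times \<open>e\<^bsub>p k\<^esub>\<close>.
\<close>

definition monomial_map ::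
    "nat \<Rightarrow> ('n::finite \<Rightarrow> 'n) \<Rightarrow> ('n \<Rightarrow> nat) \<Rightarrow> complex^'n \<Rightarrow> complex^'n" where
  "monomial_map l p a x = (\<chi> k. omega l ^ a k * x $ (inv p k))"

lemma omega_nonzero [simp]: "omega l \<noteq> 0"
  by (simp add: omega_def)

lemma omega_pow_l:
  assumes "0 < l"
  shows "omega l ^ l = 1"
  using assms by (simp add: omega_def flip: exp_of_nat_mult)

lemma omega_powi_minus:
  assumes "a < l"
  shows "omega l powi (- int a) = omega l ^ (l - a)"
proof -
  have "omega l ^ (l - a) * omega l ^ a = 1"
    using assms by (simp flip: power_add add: omega_pow_l)
  then show ?thesis
    by (simp add: power_int_minus field_simps)
qed

lemma refl_group_imp_monomial:
  assumes "w \<in> refl_group l"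
  shows "\<exists>p a. bij p \<and> w = monomial_map l p a"
  using assms
proof induction
  case id
  have "id = monomial_map l id (\<lambda>_. 0)"
    by (auto simp: monomial_map_def fun_eq_iff vec_eq_iff)
  then show ?case
    by (metis bij_id)
next
  case (sigma w i j a)
  then obtain p b where pb: "bij p" "w = monomial_map l p b"
    by blast
  let ?t = "Transposition.transpose i j"
  let ?b = "\<lambda>k. (if k = i then a else if k = j then l - a else 0) + b (?t k)"
  have "inv (?t \<circ> p) = inv p \<circ> ?t"
    using pb(1) by (simp add: o_inv_distrib)
  then have "sigma_refl l i j a \<circ> w = monomial_map l (?t \<circ> p) ?b"
    using sigma.hyps
    by (auto simp: pb sigma_refl_def monomial_map_def fun_eq_iff vec_eq_iff omega_powi_minus
        power_add)
  moreover have "bij (?t \<circ> p)"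
    using pb(1) by (simp add: bij_comp)
  ultimately show ?case
    by blast
next
  case (rot w i)
  then obtain p b where pb: "bij p" "w = monomial_map l p b"
    by blast
  have "rot l i \<circ> w = monomial_map l p (\<lambda>k. (if k = i then 1 else 0) + b k)"
    by (auto simp: pb rot_def monomial_map_def fun_eq_iff vec_eq_iff)
  then show ?case
    using pb(1) by blast
qed

lemma rot_funpow: "(rot l i ^^ m) x = (\<chi> k. if k = i then omega l ^ m * x $ i else x $ k)"
  by (induction m arbitrary: x) (auto simp: rot_def vec_eq_iff)

lemma refl_group_rot_funpow:
  assumes "w \<in> refl_group l"
  shows "(rot l i ^^ m) \<circ> w \<in> refl_group l"
  using assms by (induction m) (auto simp: comp_assoc intro: refl_group.rot)

lemma monomial_imp_refl_group:
  fixes p :: "'n::finite \<Rightarrow> 'n"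
  assumes "0 < l" and "bij p"
  shows "monomial_map l p a \<in> refl_group l"
proof -
  have "p permutes UNIV"
    using bij_imp_permutes[of p UNIV] \<open>bij p\<close> by auto
  then have perm: "monomial_map l p (\<lambda>_. 0) \<in> refl_group l"
    using finite[of "UNIV :: 'n set"]
  proof (induction rule: permutes_induct)
    case id
    have "monomial_map l id (\<lambda>_. 0) = id"
      by (auto simp: monomial_map_def fun_eq_iff vec_eq_iff)
    then show ?case
      by (metis refl_group.id)
  next
    case (swap i j p)
    let ?t = "Transposition.transpose i j"
    have "bij p"
      using swap.hyps by (simp add: permutes_bij)
    then have "inv (?t \<circ> p) = inv p \<circ> ?t"
      by (simp add: o_inv_distrib)
    then have "monomial_map l (?t \<circ> p) (\<lambda>_. 0) = sigma_refl l i j 0 \<circ> monomial_map l p (\<lambda>_. 0)"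
      using swap.hyps
      by (auto simp: sigma_refl_def monomial_map_def fun_eq_iff vec_eq_iff transpose_def)
    then show ?case
      using refl_group.sigma[OF swap.IH _ \<open>0 < l\<close>] swap.hyps by metis
  qed
  have "monomial_map l p (\<lambda>k. if k \<in> A then a k else 0) \<in> refl_group l" for A
  proof (induction A rule: finite_induct[OF finite])
    case 1
    then show ?case using perm by simp
  next
    case (2 i A)
    have "monomial_map l p (\<lambda>k. if k \<in> insert i A then a k else 0) =
          (rot l i ^^ a i) \<circ> monomial_map l p (\<lambda>k. if k \<in> A then a k else 0)"
      using 2(2) by (auto simp: monomial_map_def rot_funpow fun_eq_iff vec_eq_iff)
    then show ?case
      using refl_group_rot_funpow[OF 2(3)] by metis
  qed
  from this[of UNIV] show ?thesis
    by simp
qed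

lemma refl_group_eq:
  assumes "0 < l"
  shows "refl_group l = {monomial_map l p a |p a. bij p}"
  using refl_group_imp_monomial monomial_imp_refl_group[OF assms] by blast

definition act ::
    "(complex^'n \<Rightarrow> complex^'n) \<Rightarrow> (complex^'n::finite \<Rightarrow> complex) \<Rightarrow> complex^'n \<Rightarrow> complex" where
  "act w f x = f (inv w x)"


section \<open>Complex vector spaces of functions and irreducible representations\<close>

definition fun_scale :: "complex \<Rightarrow> ('a \<Rightarrow> complex) \<Rightarrow> 'a \<Rightarrow> complex" where
  "fun_scale c f x = c * f x"

global_interpretation cfun: vector_space "fun_scale :: complex \<Rightarrow> ('a \<Rightarrow> complex) \<Rightarrow> 'a \<Rightarrow> complex"
  by unfold_locales (auto simp: fun_scale_def fun_eq_iff algebra_simps)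

definition stable ::
    "(complex^'n \<Rightarrow> complex^'n) set \<Rightarrow> (complex^'n::finite \<Rightarrow> complex) set \<Rightarrow> bool" where
  "stable G V \<longleftrightarrow> (\<forall>w\<in>G. \<forall>f\<in>V. act w f \<in> V)"

definition irreducible_rep ::
    "(complex^'n \<Rightarrow> complex^'n) set \<Rightarrow> (complex^'n::finite \<Rightarrow> complex) set \<Rightarrow> bool" where
  "irreducible_rep G V \<longleftrightarrow>
     cfun.subspace V \<and> stable G V \<and> V \<noteq> {0} \<and>
     (\<forall>U. cfun.subspace U \<and> stable G U \<and> U \<subseteq> V \<longrightarrow> U = {0} \<or> U = V)"


section \<open>Homogeneous polynomials\<close>

text \<open>
  Polynomials in \<open>n = CARD('n)\<close> variables are identified with the functions they define
  on the \<open>n\<close>-dimensional complex space.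
\<close>

definition homogeneous_polynomial :: "nat \<Rightarrow> (complex^'n::finite \<Rightarrow> complex) \<Rightarrow> bool" where
  "homogeneous_polynomial d f \<longleftrightarrow>
     (\<exists>A C. finite A \<and> (\<forall>\<alpha>\<in>A. (\<Sum>i\<in>UNIV. \<alpha> i) = d) \<and>
        f = (\<lambda>x. \<Sum>\<alpha>\<in>A. C \<alpha> * (\<Prod>i\<in>UNIV. x $ i ^ \<alpha> i)))"


section \<open>Dunkl operators\<close>

text \<open>The parameters \<open>c\<^sub>1, \<dots>, c\<^bsub>l-1\<^esub>\<close> extended to all integers; the value \<open>c 0\<close> is ignored.\<close>

definition c_ext :: "nat \<Rightarrow> (nat \<Rightarrow> complex) \<Rightarrow> int \<Rightarrow> complex" where
  "c_ext l c k = (if k mod int l = 0 then 0 else c (nat (k mod int l)))"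

definition partial_deriv :: "'n::finite \<Rightarrow> (complex^'n \<Rightarrow> complex) \<Rightarrow> complex^'n \<Rightarrow> complex" where
  "partial_deriv i f x = deriv (\<lambda>t. f (\<chi> k. if k = i then t else x $ k)) (x $ i)"

definition dunkl ::
    "nat \<Rightarrow> complex \<Rightarrow> (nat \<Rightarrow> complex) \<Rightarrow> 'n::finite \<Rightarrow>
     (complex^'n \<Rightarrow> complex) \<Rightarrow> complex^'n \<Rightarrow> complex" where
  "dunkl l \<nu> c i f x =
     partial_deriv i f x
     - \<nu> * (\<Sum>a<l. \<Sum>j\<in>UNIV - {i}.
         1 / (x $ i - omega l ^ a * x $ j) * (f x - act (sigma_refl l i j a) f x))
     - (\<Sum>b=1..l-1. c b *
         (\<Sum>a<l. omega l powi (- int (a * b)) / x $ i * act (rot l i ^^ a) f x))"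

text \<open>
  The formula for \<^const>\<open>dunkl\<close> has poles along the reflection hyperplanes, where the
  convention \<open>y / 0 = 0\<close> would give a wrong value.  On polynomials the poles
  cancel, and the polynomial obtained is determined by its values on the dense
  complement of the hyperplanes.
\<close>

definition regular_point :: "nat \<Rightarrow> complex^'n::finite \<Rightarrow> bool" where
  "regular_point l x \<longleftrightarrow>
     (\<forall>i. x $ i \<noteq> 0) \<and> (\<forall>i j a. i \<noteq> j \<longrightarrow> a < l \<longrightarrow> x $ i \<noteq> omega l ^ a * x $ j)"

definition dunkl_vanishes ::
    "nat \<Rightarrow> complex \<Rightarrow> (nat \<Rightarrow> complex) \<Rightarrow> 'n::finite \<Rightarrow> (complex^'n \<Rightarrow> complex) \<Rightarrow> bool" where
  "dunkl_vanishes l \<nu> c i f \<longleftrightarrow> (\<forall>x. regular_point l x \<longrightarrow> dunkl l \<nu> c i f x = 0)"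


section \<open>The residue formula\<close>

text \<open>
  Meaningful if all coordinates of \<open>x\<close> are nonzero.  Whenever it is used, \<open>l \<nu>\<close> is a
  nonnegative integer, so that the choice of branch in \<open>powr\<close> is irrelevant.
  The residue is that of formal Laurent series in \<open>z\<close>, and \<open>fps_binomial \<nu>\<close> is the
  binomial series of exponent \<open>\<nu>\<close> at \<open>1 + z\<close>.
\<close>

definition residue_formula ::
    "nat \<Rightarrow> complex \<Rightarrow> nat \<Rightarrow> nat \<Rightarrow> 'n::finite \<Rightarrow> complex^'n \<Rightarrow> complex" where
  "residue_formula l \<nu> m q j x =
     (\<Prod>i\<in>UNIV. x $ i powr (of_nat l * \<nu>)) *
     fls_residue
       (fls_X_intpow (- int (l * m) - 1) *
        fps_to_fls (\<Prod>i\<in>UNIV. fps_compose (fps_binomial \<nu>) (- fps_const (1 / x $ i ^ l) * fps_X ^ l)) *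
        (fls_const (x $ j ^ q) / (fls_const (x $ j ^ l) - fls_X ^ l)))"

end

theory Submission
  imports Defs
begin

text \<open>
  Put \<open>y\<^sub>i = x\<^sub>i\<^sup>l\<close> and \<open>u = z\<^sup>l\<close>.  Up to a monomial in the \<open>x\<^sub>i\<close>, the function \<open>f\<^sub>j\<close> is the coefficient
  \<open>g\<^sub>j\<close> of \<open>u\<^sup>m\<close> in \<open>G / (1 - u / y\<^sub>j)\<close>, where \<open>G\<close> is the product of the \<open>(1 - u / y\<^sub>i)\<^sup>\<nu>\<close>.  The element
  \<open>\<sigma>\<close> for \<open>(i, j)\<close> and \<open>a\<close> exchanges \<open>f\<^sub>i\<close> and \<open>f\<^sub>j\<close> up to a root of unity, so summation over \<open>a\<close> leaves
  the difference quotients \<open>(g\<^sub>i - g\<^sub>j) / (y\<^sub>i - y\<^sub>j)\<close>, which are coefficients of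
  \<open>u G / ((y\<^sub>i - u) (y\<^sub>j - u))\<close>.  By the assumptions on \<open>c\<close> the
  \<open>s\<^sub>i\<close>-part of \<open>\<nabla>\<^sub>i f\<^sub>j\<close> is \<open>- s f\<^sub>j / x\<^sub>i\<close> if \<open>i = j\<close> and \<open>0\<close> otherwise, and the Dunkl equations reduce to
  formulas for the logarithmic derivatives of \<open>G\<close>.  The \<open>f\<^sub>j\<close> have pairwise
  different characters under the diagonal subgroup and are permuted by the symmetric group, whence
  irreducibility; they are nonzero because at \<open>x = (1, \<dots>, 1)\<close> the coefficient is up to sign the
  binomial coefficient of \<open>n \<nu> - 1\<close> over \<open>m\<close>, and \<open>n \<nu> - 1 > m - 1\<close>.
\<close>

section \<open>Roots of unity\<close>

lemma omega_pow_eq_1_iff: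
  assumes "0 < l"
  shows "omega l ^ k = 1 \<longleftrightarrow> l dvd k"
proof -
  have "omega l ^ k = exp (2 * of_real pi * \<i> * of_nat k / of_nat l)"
    by (simp add: omega_def algebra_simps flip: exp_of_nat_mult)
  then show ?thesis
    using complex_root_unity_eq_1[of l k] assms by simp
qed

lemma sum_omega_powers:
  assumes "0 < l"
  shows "(\<Sum>a<l. omega l ^ (a * k)) = (if l dvd k then of_nat l else 0)"
proof (cases "l dvd k")
  case True
  then have "omega l ^ (a * k) = 1" for a
    using omega_pow_eq_1_iff[OF assms] by simp
  then show ?thesis
    using True by simp
next
  case False
  then have "omega l ^ k \<noteq> 1"
    using omega_pow_eq_1_iff[OF assms] by simp
  moreover have "(omega l ^ k) ^ l = 1"
    using omega_pow_eq_1_iff[OF assms] by (simp flip: power_mult)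
  ultimately have "(\<Sum>a<l. (omega l ^ k) ^ a) = 0"
    by (simp add: geometric_sum)
  then show ?thesis
    using False by (simp add: power_mult mult.commute[of _ k])
qed

text \<open>The inverse of a root of unity is its conjugate, and the sum for \<open>omega l\<close>
  is real.\<close>

lemma sum_omega_powers_inverse:
  assumes "0 < l"
  shows "(\<Sum>a<l. inverse (omega l) ^ (a * k)) = (if l dvd k then of_nat l else 0)"
proof -
  have "inverse (omega l) = cnj (omega l)"
    by (simp add: omega_def exp_cnj flip: exp_minus)
  then have "(\<Sum>a<l. inverse (omega l) ^ (a * k)) = cnj (\<Sum>a<l. omega l ^ (a * k))"
    by simp
  then show ?thesis
    by (simp add: sum_omega_powers[OF assms])
qed

lemma eq_omega_mult_if_power_eq:
  assumes "0 < l" and "x ^ l = y ^ l"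
  shows "\<exists>a<l. x = omega l ^ a * y"
proof (cases "y = 0")
  case True
  then show ?thesis
    using assms by (auto simp: power_0_left)
next
  case False
  then have "(x / y) ^ l = 1"
    using assms(2) by (simp add: power_divide)
  then have "x / y \<in> (\<lambda>k. cis (2 * pi * real k / real l)) ` {..<l}"
    using Complex.bij_betw_roots_unity[OF assms(1)] by (auto simp: bij_betw_def)
  then obtain a where "a < l" and "x / y = cis (2 * pi * real a / real l)"
    by auto
  moreover have "cis (2 * pi * real a / real l) = omega l ^ a"
    by (simp add: omega_def cis_conv_exp algebra_simps flip: exp_of_nat_mult)
  ultimately show ?thesis
    using False by (metis nonzero_divide_eq_eq)
qed

text \<open>Each denominator divides \<open>x ^ l - y ^ l\<close> with a geometric sum as quotient.
  Averaging over the roots of unity then leaves the single term \<open>k = l - r\<close>. The cases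
  needed are \<open>r = l\<close>, \<open>r = q\<close> and \<open>r = l - q\<close>.\<close>

lemma sum_omega_power_div:
  assumes "1 \<le> r" and "r \<le> l" and ne: "x ^ l \<noteq> y ^ l"
  shows "(\<Sum>a<l. omega l ^ (a * r) / (x - omega l ^ a * y))
           = of_nat l * x ^ (r - 1) * y ^ (l - r) / (x ^ l - y ^ l)"
proof -
  have "0 < l" using assms by simp
  have "(\<Sum>a<l. omega l ^ (a * r) / (x - omega l ^ a * y))
      = (\<Sum>a<l. omega l ^ (a * r) *
          (\<Sum>k<l. x ^ (l - Suc k) * (omega l ^ a * y) ^ k)) / (x ^ l - y ^ l)"
    unfolding sum_divide_distrib
  proof (rule sum.cong[OF refl])
    fix a
    have "(omega l ^ a * y) ^ l = y ^ l"
      using omega_pow_l[OF \<open>0 < l\<close>] by (simp add: power_mult_distrib flip: power_mult)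
        (simp add: power_mult mult.commute[of a])
    then have eq: "x ^ l - y ^ l
        = (x - omega l ^ a * y) * (\<Sum>k<l. x ^ (l - Suc k) * (omega l ^ a * y) ^ k)"
      using power_diff_sumr2[of "omega l ^ a * y" l x]
      by (metis (no_types, lifting) minus_diff_eq minus_mult_left)
    then have "x - omega l ^ a * y \<noteq> 0"
      and "(\<Sum>k<l. x ^ (l - Suc k) * (omega l ^ a * y) ^ k) \<noteq> 0"
      using ne by auto
    then show "omega l ^ (a * r) / (x - omega l ^ a * y)
       = omega l ^ (a * r) * (\<Sum>k<l. x ^ (l - Suc k) * (omega l ^ a * y) ^ k) / (x ^ l - y ^ l)"
      using ne by (simp add: eq)
  qed
  also have "(\<Sum>a<l. omega l ^ (a * r) *
          (\<Sum>k<l. x ^ (l - Suc k) * (omega l ^ a * y) ^ k))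
       = (\<Sum>k<l. x ^ (l - Suc k) * y ^ k * (\<Sum>a<l. omega l ^ (a * (r + k))))"
    unfolding sum_distrib_left
    by (subst sum.swap)
      (simp add: power_mult_distrib power_add power_mult algebra_simps)
  also have "\<dots> = (\<Sum>k<l. if k = l - r then of_nat l * x ^ (r - 1) * y ^ (l - r) else 0)"
  proof (rule sum.cong[OF refl])
    fix k assume "k \<in> {..<l}"
    have "k = l - r" if "l dvd r + k"
    proof -
      obtain d where d: "r + k = l * d" using \<open>l dvd r + k\<close> by (rule dvdE)
      \<comment> \<open>Since 0 < r + k < 2 l, the only multiple of \<open>l\<close> that can occur
        is \<open>l\<close> itself.\<close>
      have "l * d < l * 2" unfolding d[symmetric] using assms(2) \<open>k \<in> {..<l}\<close> by simp
      then have "d = 1" using d assms(1) by (cases d) auto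
      then show ?thesis using d by simp
    qed
    then have "l dvd r + k \<longleftrightarrow> k = l - r"
      using assms(1,2) by auto
    then show "x ^ (l - Suc k) * y ^ k * (\<Sum>a<l. omega l ^ (a * (r + k)))
        = (if k = l - r then of_nat l * x ^ (r - 1) * y ^ (l - r) else 0)"
      using assms(1,2) \<open>0 < l\<close> by (auto simp: sum_omega_powers)
  qed
  also have "\<dots> = of_nat l * x ^ (r - 1) * y ^ (l - r)"
    using assms(1,2) by simp
  finally show ?thesis .
qed

section \<open>Binomial series\<close>

lemma fps_deriv_prod:
  fixes F :: "'a \<Rightarrow> 'b::comm_ring_1 fps"
  assumes "finite S"
  shows "fps_deriv (\<Prod>k\<in>S. F k) = (\<Sum>k\<in>S. fps_deriv (F k) * (\<Prod>i\<in>S - {k}. F i))"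
  using assms
proof induction
  case (insert j S)
  have "(\<Prod>i\<in>insert j S - {k}. F i) = F j * (\<Prod>i\<in>S - {k}. F i)" if "k \<in> S" for k
    using insert.hyps that by (auto simp: insert_Diff_if)
  then show ?case
    using insert by (simp add: sum_distrib_left mult_ac add.commute)
qed simp

lemma fps_nth_prod:
  fixes F :: "'i::finite \<Rightarrow> 'b::comm_ring_1 fps"
  shows "(\<Prod>i\<in>UNIV. F i) $ m = (\<Sum>\<kappa>\<in>{\<kappa>. (\<Sum>i\<in>UNIV. \<kappa> i) = m}. \<Prod>i\<in>UNIV. F i $ \<kappa> i)"
proof -
  \<comment> \<open>Forcing the value 0 outside \<open>I\<close> makes these index sets finite and
    lets the induction add one index at a time.\<close>
  define K where "K I m = {\<kappa>::'i \<Rightarrow> nat. (\<Sum>i\<in>I. \<kappa> i) = m \<and> (\<forall>i. i \<notin> I \<longrightarrow> \<kappa> i = 0)}" for I m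
  have "(\<Prod>i\<in>I. F i) $ m = (\<Sum>\<kappa>\<in>K I m. \<Prod>i\<in>I. F i $ \<kappa> i)" for I
  proof (induction I arbitrary: m rule: finite_induct[OF finite])
    case (1 m)
    have "K {} m = (if m = 0 then {\<lambda>_. 0} else {})"
      by (auto simp: K_def)
    then show ?case by simp
  next
    case (2 j I m)
    have fin: "finite (K I n)" for n
    proof (rule finite_subset)
      show "K I n \<subseteq> PiE UNIV (\<lambda>_. {..n})"
        using member_le_sum[of _ I] by (fastforce simp: K_def)
    qed (simp add: finite_PiE)
    have "(\<Sum>\<kappa>\<in>K (insert j I) m. \<Prod>i\<in>insert j I. F i $ \<kappa> i)
        = (\<Sum>(k, \<kappa>)\<in>(SIGMA k:{0..m}. K I (m - k)). F j $ k * (\<Prod>i\<in>I. F i $ \<kappa> i))"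
    proof (rule sum.reindex_bij_witness[where i = "\<lambda>(k, \<kappa>). \<kappa>(j := k)" and j = "\<lambda>\<kappa>. (\<kappa> j, \<kappa>(j := 0))"])
      show "(case (\<kappa> j, \<kappa>(j := 0)) of (k, \<kappa>) \<Rightarrow> F j $ k * (\<Prod>i\<in>I. F i $ \<kappa> i)) =
         (\<Prod>i\<in>insert j I. F i $ \<kappa> i)" for \<kappa>
      proof -
        have "(\<Prod>i\<in>I. F i $ (\<kappa>(j := 0)) i) = (\<Prod>i\<in>I. F i $ \<kappa> i)"
          using 2(2) by (intro prod.cong) auto
        then show ?thesis
          using 2(1,2) by simp
      qed
    next
      show "(\<kappa> j, \<kappa>(j := 0)) \<in> (SIGMA k:{0..m}. K I (m - k))"
        if "\<kappa> \<in> K (insert j I) m" for \<kappa>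
      proof -
        have "sum (\<kappa>(j := 0)) I = sum \<kappa> I"
          using 2(2) by (intro sum.cong) auto
        then show ?thesis
          using that 2(1,2) by (auto simp: K_def)
      qed
    next
      fix b assume b: "b \<in> (SIGMA k:{0..m}. K I (m - k))"
      obtain k \<kappa> where [simp]: "b = (k, \<kappa>)" by fastforce
      have "sum (\<kappa>(j := k)) I = sum \<kappa> I"
        using 2(2) by (intro sum.cong) auto
      then show "(case b of (k, \<kappa>) \<Rightarrow> \<kappa>(j := k)) \<in> K (insert j I) m"
        using b 2(1,2) by (auto simp: K_def)
      show "((case b of (k, \<kappa>) \<Rightarrow> \<kappa>(j := k)) j, (case b of (k, \<kappa>) \<Rightarrow> \<kappa>(j := k))(j := 0)) = b"
        using b 2(2) by (auto simp: K_def fun_eq_iff)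
    qed auto
    also have "\<dots> = (\<Sum>k=0..m. F j $ k * (\<Prod>i\<in>I. F i) $ (m - k))"
      by (subst sum.Sigma[symmetric]) (auto simp: fin 2(3) sum_distrib_left)
    finally show ?case
      using 2(1,2) by (simp add: fps_mult_nth)
  qed
  from this[of UNIV] show ?thesis
    by (simp add: K_def)
qed

lemma fps_X_deriv_nth: "(fps_X * fps_deriv F) $ m = of_nat m * F $ m" for F :: "'a::comm_ring_1 fps"
  by (cases m) auto

lemma fps_mult_const_nth: "(fps_const a * F) $ m = a * F $ m" for F :: "'a::comm_ring_1 fps"
  by simp

text \<open>The expansion of \<open>(1 - c X)\<^sup>a\<close>.\<close>

definition binomial_series :: "complex \<Rightarrow> complex \<Rightarrow> complex fps" where
  "binomial_series a c = fps_compose (fps_binomial a) (fps_const (- c) * fps_X)"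

lemma binomial_series_nth: "binomial_series a c $ k = (- c) ^ k * (a gchoose k)"
  unfolding binomial_series_def by (subst fps_nth_compose_linear) simp

lemma binomial_series_add: "binomial_series (a + b) c = binomial_series a c * binomial_series b c"
  by (simp add: binomial_series_def fps_binomial_add_mult fps_compose_mult_distrib)

lemma binomial_series_0: "binomial_series 0 c = 1"
  by (simp add: binomial_series_def)

lemma binomial_series_sum: "binomial_series (\<Sum>i\<in>I. a i) c = (\<Prod>i\<in>I. binomial_series (a i) c)"
  by (induction I rule: infinite_finite_induct)
    (simp_all add: binomial_series_0 binomial_series_add)

lemma binomial_series_1: "binomial_series 1 c = 1 - fps_const c * fps_X"
proof -
  have "fps_binomial 1 = (1 + fps_X :: complex fps)"
    using fps_binomial_of_nat[of 1] by simp
  then show ?thesis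
    by (simp add: binomial_series_def fps_compose_add_distrib flip: fps_const_neg)
qed

lemma binomial_series_minus_1:
  "binomial_series a c = (1 - fps_const c * fps_X) * binomial_series (a - 1) c"
  using binomial_series_add[of 1 "a - 1" c] by (simp add: binomial_series_1)

lemma binomial_series_deriv:
  "fps_deriv (binomial_series a c) = fps_const (- a * c) * binomial_series (a - 1) c"
proof (rule fps_ext)
  fix k
  have "(a gchoose Suc k) * of_nat (Suc k) = a * (a - 1 gchoose k)"
    using gbinomial_absorption'[of "Suc k" a] by (simp del: of_nat_Suc)
  then show "fps_deriv (binomial_series a c) $ k
      = (fps_const (- a * c) * binomial_series (a - 1) c) $ k"
    by (simp add: binomial_series_nth algebra_simps del: of_nat_Suc) 
qed

text \<open>No factor \<open>r - i\<close> of the falling factorial vanishes, because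
  \<open>i \<le> m - 1 < r\<close>.\<close>

lemma gchoose_of_real_ne_0:
  assumes "r > real m - 1"
  shows "complex_of_real r gchoose m \<noteq> 0"
proof -
  have "complex_of_real r - of_nat i \<noteq> 0" if "i < m" for i
  proof -
    have "real i \<le> real m - 1" using that by linarith
    then have "r \<noteq> real i" using assms by linarith
    then show ?thesis by (metis eq_iff_diff_eq_0 of_real_eq_iff of_real_of_nat_eq)
  qed
  then have "(\<Prod>i = 0..<m. complex_of_real r - of_nat i) \<noteq> 0"
    by simp
  then show ?thesis
    using gbinomial_mult_fact[of m "complex_of_real r"] by auto
qed

text \<open>The coefficient of index \<open>k\<close> is a constant times the power
  \<open>- l k\<close> of \<open>t\<close>, so \<open>d/dt\<close> multiplies it by
  \<open>- l k / t\<close>; the factor \<open>k\<close> comes from \<open>X d/dX\<close>. The series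
  \<open>R\<close> does not depend on \<open>t\<close>.\<close>

lemma has_field_derivative_binomial_series:
  assumes "t \<noteq> 0"
  shows "((\<lambda>t. (binomial_series a (1 / t ^ l) * R) $ m) has_field_derivative
     - of_nat l / t * (fps_X * fps_deriv (binomial_series a (1 / t ^ l)) * R) $ m) (at t)"
proof -
  have "((\<lambda>t. binomial_series a (1 / t ^ l) $ k) has_field_derivative
     - of_nat l / t * (fps_X * fps_deriv (binomial_series a (1 / t ^ l))) $ k) (at t)" for k
  proof -
    have eq: "(- (1 / t ^ l)) ^ k = (-1) ^ k * inverse (t ^ (l * k))" for t :: complex
      by (subst power_minus) (simp add: power_mult power_inverse divide_inverse)
    have "((\<lambda>t. inverse (t ^ n)) has_field_derivative - (of_nat n / t) * inverse (t ^ n)) (at t)" for n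
      using assms by (intro DERIV_cong[OF DERIV_inverse_fun[OF DERIV_power[OF DERIV_ident]]])
        (cases n; simp add: field_simps)+
    from DERIV_cmult[OF this[of "l * k"], of "(-1) ^ k * (a gchoose k)"] show ?thesis
      unfolding fps_X_deriv_nth binomial_series_nth eq by (simp add: mult_ac)
  qed
  then show ?thesis
    unfolding fps_mult_nth[of _ R] sum_distrib_left
    by (auto intro!: derivative_eq_intros sum.cong)
qed

section \<open>Generating series and their difference quotients\<close>

text \<open>
  With \<open>c i = 1 / x\<^sub>i\<^sup>l\<close>, the coefficient of \<open>X\<^sup>m\<close> is the one which the residue extracts
  (the variable \<open>X\<close> is \<open>z\<^sup>l\<close>).
\<close>

definition gen_series :: "complex \<Rightarrow> ('n::finite \<Rightarrow> complex) \<Rightarrow> 'n \<Rightarrow> complex fps" where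
  "gen_series \<nu> c j = (\<Prod>i\<in>UNIV. binomial_series (if i = j then \<nu> - 1 else \<nu>) (c i))"

text \<open>For \<open>i \<noteq> j\<close> this is \<open>G / ((1 - c i X) (1 - c j X))\<close>,
  where \<open>G\<close> is the product of all \<open>binomial_series \<nu> (c k)\<close>.\<close>

definition gen_series2 :: "complex \<Rightarrow> ('n::finite \<Rightarrow> complex) \<Rightarrow> 'n \<Rightarrow> 'n \<Rightarrow> complex fps" where
  "gen_series2 \<nu> c i j = binomial_series (\<nu> - 1) (c i) * binomial_series (\<nu> - 1) (c j) *
     (\<Prod>k\<in>UNIV - {i} - {j}. binomial_series \<nu> (c k))"

lemma gen_series2_commute: "gen_series2 \<nu> c i j = gen_series2 \<nu> c j i"
  unfolding gen_series2_def by (simp add: mult_ac Diff_insert[symmetric] insert_commute)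

lemma prod_UNIV_remove:
  fixes h :: "'n::finite \<Rightarrow> 'b::comm_monoid_mult"
  shows "(\<Prod>i\<in>UNIV. h i) = h j * (\<Prod>i\<in>UNIV - {j}. h i)"
  by (simp add: prod.remove)

lemma gen_series_split:
  "gen_series \<nu> c j = binomial_series (\<nu> - 1) (c j) * (\<Prod>k\<in>UNIV - {j}. binomial_series \<nu> (c k))"
  unfolding gen_series_def by (subst prod_UNIV_remove[of _ j]) simp

lemma gen_series_via_gen_series2:
  assumes "i \<noteq> j"
  shows "gen_series \<nu> c j = (1 - fps_const (c i) * fps_X) * gen_series2 \<nu> c i j"
proof -
  have "(\<Prod>k\<in>UNIV - {j}. binomial_series \<nu> (c k))
      = binomial_series \<nu> (c i) * (\<Prod>k\<in>UNIV - {j} - {i}. binomial_series \<nu> (c k))"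
    using assms by (intro prod.remove) auto
  moreover have "UNIV - {j} - {i} = UNIV - {i} - {j}"
    by auto
  ultimately show ?thesis
    unfolding gen_series_split gen_series2_def
    using binomial_series_minus_1[of \<nu> "c i"] by (simp add: mult_ac)
qed

text \<open>Both series are \<open>gen_series2 \<nu> c i j\<close> times a linear factor, and the
  linear factors differ by \<open>(c i - c j) X\<close>.\<close>

lemma gen_series_diff:
  assumes "i \<noteq> j"
  shows "gen_series \<nu> c i - gen_series \<nu> c j = fps_const (c i - c j) * (fps_X * gen_series2 \<nu> c i j)"
proof -
  have "gen_series \<nu> c i = (1 - fps_const (c j) * fps_X) * gen_series2 \<nu> c i j"
    using gen_series_via_gen_series2[of j i] assms gen_series2_commute[of \<nu> c i j] by simp
  moreover have "(1 - b * X) * W - (1 - a * X) * W = (a - b) * (X * W)" for a b X W :: "complex fps"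
    by (simp add: algebra_simps)
  ultimately show ?thesis
    unfolding gen_series_via_gen_series2[OF assms] fps_const_sub[symmetric] by metis
qed

lemma gen_series_diff_nth:
  assumes "i \<noteq> j" and "c i \<noteq> c j"
  shows "(fps_X * gen_series2 \<nu> c i j) $ m
    = (gen_series \<nu> c i $ m - gen_series \<nu> c j $ m) / (c i - c j)"
proof -
  have "gen_series \<nu> c i $ m - gen_series \<nu> c j $ m = (c i - c j) * (fps_X * gen_series2 \<nu> c i j) $ m"
    by (simp only: gen_series_diff[OF assms(1)] fps_mult_const_nth flip: fps_sub_nth)
  then show ?thesis
    using assms(2) by simp
qed

text \<open>
  Since \<open>x\<^sub>i \<partial>/\<partial>x\<^sub>i\<close> acts on \<open>(1 - X / x\<^sub>i\<^sup>l)\<^sup>a\<close> as \<open>- l X d/dX\<close>, the following two identities are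
  the Dunkl equations for \<open>i = j\<close> and \<open>i \<noteq> j\<close> with the monomial prefactor removed.
\<close>

lemma gen_series_deriv_same:
  assumes "\<And>k. k \<noteq> i \<Longrightarrow> c k \<noteq> c i"
  shows "of_nat m * gen_series \<nu> c i $ m
      - (fps_X * fps_deriv (binomial_series (\<nu> - 1) (c i)) *
          (\<Prod>k\<in>UNIV - {i}. binomial_series \<nu> (c k))) $ m
    = \<nu> * (\<Sum>k\<in>UNIV - {i}. c k / (c k - c i) * (gen_series \<nu> c i $ m - gen_series \<nu> c k $ m))"
proof -
  let ?R = "\<Prod>k\<in>UNIV - {i}. binomial_series \<nu> (c k)"
  have "X * (D * R + B * R') - X * D * R = X * (B * R')" for X B D R R' :: "complex fps"
    by (simp add: algebra_simps)
  \<comment> \<open>By the Leibniz rule, the subtracted term removes the part of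
    \<open>X d/dX\<close> in which factor \<open>i\<close> is differentiated.\<close>
  then have "of_nat m * gen_series \<nu> c i $ m - (fps_X * fps_deriv (binomial_series (\<nu> - 1) (c i)) * ?R) $ m
      = (fps_X * (binomial_series (\<nu> - 1) (c i) * fps_deriv ?R)) $ m"
    unfolding fps_X_deriv_nth[symmetric] gen_series_split fps_deriv_mult fps_sub_nth[symmetric]
    by (metis add.commute)
  \<comment> \<open>Differentiating factor \<open>k\<close> lowers its exponent to
    \<open>\<nu> - 1\<close>; factor \<open>i\<close> is lowered already, so
    \<open>gen_series2\<close> appears.\<close>
  also have "fps_X * (binomial_series (\<nu> - 1) (c i) * fps_deriv ?R)
      = (\<Sum>k\<in>UNIV - {i}. fps_const (- \<nu> * c k) * (fps_X * gen_series2 \<nu> c i k))"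
    by (simp only: fps_deriv_prod finite sum_distrib_left binomial_series_deriv gen_series2_def mult_ac)
  also have "\<dots> $ m = (\<Sum>k\<in>UNIV - {i}. \<nu> *
      (c k / (c k - c i) * (gen_series \<nu> c i $ m - gen_series \<nu> c k $ m)))"
    unfolding fps_sum_nth fps_mult_const_nth
  proof (rule sum.cong[OF refl])
    fix k assume "k \<in> UNIV - {i}"
    then have k: "i \<noteq> k" "c i \<noteq> c k"
      using assms[of k] by auto
    show "- \<nu> * c k * (fps_X * gen_series2 \<nu> c i k) $ m =
         \<nu> * (c k / (c k - c i) * (gen_series \<nu> c i $ m - gen_series \<nu> c k $ m))"
      unfolding gen_series_diff_nth[OF k] using k(2) by (simp add: field_simps)
  qed
  finally show ?thesis
    by (simp only: sum_distrib_left)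
qed

lemma gen_series_deriv_other:
  assumes "i \<noteq> j" and "c i \<noteq> c j"
  shows "- ((fps_X * fps_deriv (binomial_series \<nu> (c i)) *
      (\<Prod>k\<in>UNIV - {i}. binomial_series (if k = j then \<nu> - 1 else \<nu>) (c k))) $ m)
    = \<nu> * (c i / (c j - c i) * (gen_series \<nu> c j $ m - gen_series \<nu> c i $ m))"
proof -
  have "(\<Prod>k\<in>UNIV - {i}. binomial_series (if k = j then \<nu> - 1 else \<nu>) (c k))
     = binomial_series (\<nu> - 1) (c j) * (\<Prod>k\<in>UNIV - {i} - {j}. binomial_series \<nu> (c k))"
    using assms by (subst prod.remove[of _ j]) auto
  then have "fps_X * fps_deriv (binomial_series \<nu> (c i)) *
      (\<Prod>k\<in>UNIV - {i}. binomial_series (if k = j then \<nu> - 1 else \<nu>) (c k))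
     = fps_const (- \<nu> * c i) * (fps_X * gen_series2 \<nu> c i j)"
    by (simp only: binomial_series_deriv gen_series2_def mult_ac)
  then show ?thesis
    using assms(2) by (simp only: fps_mult_const_nth gen_series_diff_nth[OF assms]) (simp add: field_simps)
qed

text \<open>With all arguments equal to 1 the exponents add up to \<open>n r - 1\<close>, where
  \<open>n = CARD('n)\<close>, and \<open>n r - 1 \<ge> r - 1 > m - 1\<close>.\<close>

lemma gen_series_one_nth_ne_0:
  assumes "0 < r" and "\<nu> = complex_of_real r" and "r - 1 > real m - 1"
  shows "gen_series \<nu> (\<lambda>i::'n::finite. 1) j $ m \<noteq> 0"
proof -
  have "(\<Sum>i\<in>(UNIV::'n set). if i = j then \<nu> - 1 else \<nu>) = (\<nu> - 1) + (\<Sum>i\<in>UNIV - {j}. \<nu>)"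
    by (subst sum.remove[of _ j]) auto
  also have "\<dots> = complex_of_real (r - 1 + real (card (UNIV - {j})) * r)"
    by (simp add: assms(2))
  finally have eq: "gen_series \<nu> (\<lambda>i. 1) j
      = binomial_series (complex_of_real (r - 1 + real (card (UNIV - {j})) * r)) 1"
    by (simp add: gen_series_def flip: binomial_series_sum)
  have "0 \<le> real (card (UNIV - {j})) * r"
    using assms(1) by simp
  then have "r - 1 + real (card (UNIV - {j})) * r > real m - 1"
    using assms(3) by linarith
  from gchoose_of_real_ne_0[OF this] show ?thesis
    unfolding eq binomial_series_nth by simp
qed

section \<open>The singular polynomials\<close>

lemma act_scale: "act w (fun_scale a u) = fun_scale a (act w u)"
  by (simp add: act_def fun_scale_def fun_eq_iff)

lemma act_sum: "act w (\<Sum>k\<in>A. u k) = (\<Sum>k\<in>A. act w (u k))"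
  by (induction A rule: infinite_finite_induct) (simp_all add: act_def fun_eq_iff)

locale singular_parameters =
  fixes l q m s :: nat and \<nu> :: complex
  assumes l_ge: "l \<ge> 2" and q_ge: "1 \<le> q" and q_le: "q \<le> l - 1"
    and nu: "\<nu> = of_nat m + (of_nat l - of_nat q + of_nat s) / of_nat l"
begin

lemma l_pos: "0 < l"
  using l_ge by simp

lemma q_less: "q < l"
  using q_le l_ge by simp

lemma l_nu: "of_nat l * \<nu> = of_nat (l * m + (l - q + s))"
  using l_pos q_less by (simp add: nu field_simps of_nat_diff)

text \<open>The exponent modulo \<open>l\<close> of \<open>x\<^sub>i\<close> in \<open>f\<^sub>j\<close>, according to whether \<open>i = j\<close>.\<close>

definition twist :: "bool \<Rightarrow> nat" where
  "twist b = (if b then s else l - q + s)"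

text \<open>The contribution of one coordinate: coefficient \<open>k\<close> of the binomial series
  with argument \<open>1 / t ^ l\<close>, times \<open>t ^ (l * m + twist b)\<close>. The parts of a
  composition of \<open>m\<close> are at most \<open>m\<close>, so the truncated
  \<open>m - k\<close> is exact where it is used.\<close>

definition factor :: "bool \<Rightarrow> nat \<Rightarrow> complex \<Rightarrow> complex" where
  "factor b k t = (- 1) ^ k * ((if b then \<nu> - 1 else \<nu>) gchoose k) * t ^ (l * (m - k) + twist b)"

text \<open>
  The coefficient of \<open>z\<^bsup>l m\<^esup>\<close> in the product of the binomial series, expanded so that no
  negative power of a coordinate occurs.
\<close>

definition sing_poly :: "'n::finite \<Rightarrow> complex^'n \<Rightarrow> complex" where
  "sing_poly j x = (\<Sum>\<kappa>\<in>{\<kappa>. (\<Sum>i\<in>UNIV. \<kappa> i) = m}. \<Prod>i\<in>UNIV. factor (i = j) (\<kappa> i) (x $ i))"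

lemma finite_compositions: "finite {\<kappa>::'n::finite \<Rightarrow> nat. (\<Sum>i\<in>UNIV. \<kappa> i) = m}"
proof (rule finite_subset)
  show "{\<kappa>::'n \<Rightarrow> nat. (\<Sum>i\<in>UNIV. \<kappa> i) = m} \<subseteq> PiE UNIV (\<lambda>_. {..m})"
    by (auto intro: member_le_sum)
qed (simp add: finite_PiE)

text \<open>Where no coordinate vanishes, a common monomial can be pulled out of all summands. The
  differential and difference computations below use this form.\<close>

lemma sing_poly_eq:
  fixes x :: "complex^'n::finite"
  assumes "\<And>i. x $ i \<noteq> 0"
  shows "sing_poly j x =
    (\<Prod>i\<in>UNIV. x $ i ^ (l * m + twist (i = j))) * gen_series \<nu> (\<lambda>i. 1 / x $ i ^ l) j $ m"
  unfolding sing_poly_def gen_series_def fps_nth_prod sum_distrib_left prod.distrib[symmetric]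
proof (rule sum.cong[OF refl], rule prod.cong[OF refl])
  fix \<kappa> :: "'n \<Rightarrow> nat" and i :: 'n
  assume "\<kappa> \<in> {\<kappa>. (\<Sum>i\<in>UNIV. \<kappa> i) = m}"
  then have "\<kappa> i \<le> m"
    using member_le_sum[of i UNIV \<kappa>] by simp
  then have "l * m + twist (i = j) = (l * (m - \<kappa> i) + twist (i = j)) + l * \<kappa> i"
    by (auto simp: le_iff_add algebra_simps)
  then have "x $ i ^ (l * m + twist (i = j))
      = x $ i ^ (l * (m - \<kappa> i) + twist (i = j)) * (x $ i ^ l) ^ \<kappa> i"
    by (simp only: power_add power_mult)
  moreover have "(x $ i ^ l) ^ \<kappa> i * (- (1 / x $ i ^ l)) ^ \<kappa> i = (- 1) ^ \<kappa> i"
    using assms by (simp flip: power_mult_distrib)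
  ultimately show "factor (i = j) (\<kappa> i) (x $ i) = x $ i ^ (l * m + twist (i = j)) *
     binomial_series (if i = j then \<nu> - 1 else \<nu>) (1 / x $ i ^ l) $ \<kappa> i"
    unfolding factor_def binomial_series_nth by (simp add: mult_ac)
qed

text \<open>Apart from the power of \<open>z\<close> in front, the residue is taken of a power
  series in \<open>z ^ l\<close>. The denominator contributes exponent -1 at index \<open>j\<close>,
  which lowers \<open>\<nu>\<close> there to \<open>\<nu> - 1\<close>.\<close>

lemma sing_poly_eq_residue_formula:
  fixes x :: "complex^'n::finite"
  assumes nz: "\<And>i. x $ i \<noteq> 0"
  shows "sing_poly j x = residue_formula l \<nu> m q j x"
proof -
  define y where "y i = x $ i ^ l" for i
  have y_nz: "y i \<noteq> 0" for i
    using nz by (simp add: y_def)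
  have X0: "(fps_X ^ l :: complex fps) $ 0 = 0"
    using l_pos by simp
  have comp: "fps_compose (fps_binomial a) (- fps_const c * fps_X ^ l)
      = fps_compose (binomial_series a c) (fps_X ^ l)" for a c
  proof -
    have "- fps_const c * fps_X ^ l = fps_compose (fps_const (- c) * fps_X) (fps_X ^ l)"
      using X0 by (simp add: fps_compose_mult_distrib)
    moreover have "(fps_const (- c) * fps_X) $ 0 = 0"
      by simp
    ultimately show ?thesis
      unfolding binomial_series_def by (simp only: fps_compose_assoc[OF X0])
  qed
  \<comment> \<open>The expansion of the quotient in the residue as a power series in
    \<open>z\<close>.\<close>
  define H where "H = fps_const (x $ j ^ q / y j) * fps_compose (binomial_series (- 1) (1 / y j)) (fps_X ^ l)"
  have "fps_compose (binomial_series 1 (1 / y j)) (fps_X ^ l) = 1 - fps_const (1 / y j) * fps_X ^ l"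
    using X0 by (simp add: binomial_series_1 fps_compose_sub_distrib fps_compose_mult_distrib)
  then have den: "fps_const (y j) - fps_X ^ l
      = fps_const (y j) * fps_compose (binomial_series 1 (1 / y j)) (fps_X ^ l)"
    using y_nz by (simp add: right_diff_distrib flip: mult.assoc)
  have "fps_compose (binomial_series (- 1) (1 / y j)) (fps_X ^ l) *
        fps_compose (binomial_series 1 (1 / y j)) (fps_X ^ l) = 1"
    using X0 by (simp add: binomial_series_0 flip: fps_compose_mult_distrib binomial_series_add)
  then have "H * (fps_const (y j) - fps_X ^ l) = fps_const (x $ j ^ q)"
    using y_nz unfolding H_def den
    by (metis (no_types, lifting) fps_const_mult mult.assoc mult.commute mult.right_neutral
        nonzero_eq_divide_eq)
  then have "fls_const (x $ j ^ q) = fps_to_fls H * (fls_const (y j) - fls_X ^ l)"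
    by (metis fls_times_fps_to_fls fps_X_to_fls fps_const_to_fls fps_to_fls_minus fps_to_fls_power)
  \<comment> \<open>The nonzero constant term permits cancelling the denominator in the field of
    Laurent series.\<close>
  moreover have "fls_const (y j) - fls_X ^ l \<noteq> 0"
  proof -
    have "(fps_const (y j) - fps_X ^ l) $ 0 \<noteq> 0"
      using X0 y_nz by simp
    then have "fps_to_fls (fps_const (y j) - fps_X ^ l) \<noteq> 0"
      by (metis fps_to_fls_eq_0_iff fps_zero_nth)
    then show ?thesis
      by (simp add: fps_to_fls_power)
  qed
  ultimately have quot: "fls_const (x $ j ^ q) / (fls_const (y j) - fls_X ^ l) = fps_to_fls H"
    by (metis nonzero_mult_div_cancel_right)
  have "(\<Prod>i\<in>UNIV. binomial_series \<nu> (1 / y i)) * binomial_series (- 1) (1 / y j)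
      = gen_series \<nu> (\<lambda>i. 1 / y i) j"
    unfolding gen_series_split prod_UNIV_remove[of _ j]
    using binomial_series_add[of \<nu> "- 1" "1 / y j"] by (simp add: mult_ac)
  then have prod_H: "(\<Prod>i\<in>UNIV. fps_compose (binomial_series \<nu> (1 / y i)) (fps_X ^ l)) * H
      = fps_const (x $ j ^ q / y j) * fps_compose (gen_series \<nu> (\<lambda>i. 1 / y i) j) (fps_X ^ l)"
    unfolding H_def
    by (simp only: fps_compose_mult_distrib[OF X0] fps_compose_prod_distrib[OF X0] mult.left_commute
        flip: \<open>_ = gen_series _ _ _\<close>)
  have "residue_formula l \<nu> m q j x = (\<Prod>i\<in>UNIV. x $ i powr (of_nat l * \<nu>)) *
      fls_residue (fls_X_intpow (- int (l * m) - 1) *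
        (fps_to_fls (\<Prod>i\<in>UNIV. fps_compose (binomial_series \<nu> (1 / y i)) (fps_X ^ l)) * fps_to_fls H))"
    unfolding residue_formula_def comp y_def[symmetric] quot mult.assoc ..
  \<comment> \<open>The shift moves index \<open>l m\<close> to index -1; before the substitution of
    \<open>X ^ l\<close> this is index \<open>m\<close>.\<close>
  also have "\<dots> = (\<Prod>i\<in>UNIV. x $ i powr (of_nat l * \<nu>)) *
      (x $ j ^ q / y j * gen_series \<nu> (\<lambda>i. 1 / y i) j $ m)"
    unfolding fls_times_fps_to_fls[symmetric] prod_H fls_X_intpow_times_conv_shift(1)
    using l_pos by (simp add: fps_nth_compose_X_power nat_mult_distrib mult_less_0_iff)
  also have "(\<Prod>i\<in>UNIV. x $ i powr (of_nat l * \<nu>)) * (x $ j ^ q / y j * gen_series \<nu> (\<lambda>i. 1 / y i) j $ m)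
     = (\<Prod>i\<in>UNIV. x $ i ^ (l * m + twist (i = j))) * gen_series \<nu> (\<lambda>i. 1 / y i) j $ m"
  proof -
    \<comment> \<open>The prefactor has exponent \<open>l \<nu> = l m + (l - q + s)\<close>; at
      index \<open>j\<close> the factor \<open>x $ j ^ q / y j\<close> lowers it to
      \<open>l m + s\<close>.\<close>
    have "x $ j ^ (l * m + (l - q + s)) * x $ j ^ q = x $ j ^ (l * m + s) * x $ j ^ l"
      using q_less by (simp add: add_ac flip: power_add)
    then have K: "x $ j ^ (l * m + (l - q + s)) * (x $ j ^ q / y j) = x $ j ^ (l * m + s)"
      using y_nz[of j] by (simp add: y_def field_simps)
    show ?thesis
      unfolding l_nu prod_UNIV_remove[of _ j] using nz
      by (simp add: powr_nat' twist_def mult_ac flip: K del: of_nat_add of_nat_mult)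
  qed
  finally show ?thesis
    unfolding sing_poly_eq[OF nz] y_def by simp
qed

lemma sing_poly_homogeneous:
  "homogeneous_polynomial ((CARD('n) - 1) * (m * l + l - q) + CARD('n) * s)
     (sing_poly (j::'n::finite))"
proof -
  let ?K = "{\<kappa>::'n \<Rightarrow> nat. (\<Sum>i\<in>UNIV. \<kappa> i) = m}"
  \<comment> \<open>The exponent vector of the monomial attached to \<open>\<kappa>\<close>. It
    determines \<open>\<kappa>\<close>, so the sum can be reindexed by exponent vectors.\<close>
  define e where "e \<kappa> i = l * (m - \<kappa> i) + twist (i = j)" for \<kappa> and i :: 'n
  define C where "C \<kappa> = (\<Prod>i\<in>UNIV. (- 1) ^ \<kappa> i * ((if i = j then \<nu> - 1 else \<nu>) gchoose \<kappa> i))" for \<kappa>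
  have le: "\<kappa> i \<le> m" if "\<kappa> \<in> ?K" for \<kappa> i
    using member_le_sum[of i UNIV \<kappa>] that by simp
  have inj: "inj_on e ?K"
  proof (rule inj_onI, rule ext)
    fix \<kappa> \<kappa>' i assume a: "\<kappa> \<in> ?K" "\<kappa>' \<in> ?K" "e \<kappa> = e \<kappa>'"
    then have "m - \<kappa> i = m - \<kappa>' i"
      using l_pos by (auto simp: e_def dest!: fun_cong[of _ _ i])
    then show "\<kappa> i = \<kappa>' i"
      using le[OF a(1), of i] le[OF a(2), of i] by simp
  qed
  have "sing_poly j = (\<lambda>x. \<Sum>\<alpha>\<in>e ` ?K. C (the_inv_into ?K e \<alpha>) * (\<Prod>i\<in>UNIV. x $ i ^ \<alpha> i))"
  proof
    fix x
    show "sing_poly j x = (\<Sum>\<alpha>\<in>e ` ?K. C (the_inv_into ?K e \<alpha>) * (\<Prod>i\<in>UNIV. x $ i ^ \<alpha> i))"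
      unfolding sum.reindex[OF inj] sing_poly_def
      by (rule sum.cong[OF refl])
        (simp add: the_inv_into_f_f[OF inj] C_def e_def factor_def prod.distrib)
  qed
  moreover have "(\<Sum>i\<in>UNIV. e \<kappa> i) = (CARD('n) - 1) * (m * l + l - q) + CARD('n) * s"
    if "\<kappa> \<in> ?K" for \<kappa>
  proof -
    \<comment> \<open>Naming \<open>l - q\<close> and \<open>CARD('n) - 1\<close> removes truncated
      subtraction from the degree count.\<close>
    obtain d where d: "m * l + l - q = m * l + d" "l - q = d"
      by (rule that[of "l - q"]) (use q_less in simp_all)
    obtain n where n: "CARD('n) = Suc n"
      using zero_less_card_finite[where ?'a = 'n] by (metis gr0_conv_Suc)
    have "(\<Sum>i\<in>UNIV. m - \<kappa> i) = Suc n * m - m"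
      using that le[OF that] by (simp add: sum_subtractf_nat n)
    then have "(\<Sum>i\<in>UNIV. l * (m - \<kappa> i)) = l * (n * m)"
      by (simp flip: sum_distrib_left)
    moreover have "(\<Sum>i\<in>UNIV. twist (i = j)) = s + n * (d + s)"
      by (subst sum.remove[of _ j]) (simp_all add: twist_def n d card_Diff_singleton)
    ultimately show ?thesis
      unfolding d by (simp add: e_def sum.distrib n add_mult_distrib2 mult_ac)
  qed
  ultimately show ?thesis
    unfolding homogeneous_polynomial_def
    by (intro exI[of _ "e ` ?K"] exI[of _ "\<lambda>\<alpha>. C (the_inv_into ?K e \<alpha>)"])
      (use finite_compositions in auto)
qed

section \<open>The group action\<close>

text \<open>Exponents matter only modulo \<open>l\<close>, so the scalar \<open>t i\<close> leaves
  just its \<open>twist\<close> power, and the permutation is absorbed by reindexing compositions.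
  All group actions below reduce to this.\<close>

lemma sing_poly_monomial:
  fixes p :: "'n::finite \<Rightarrow> 'n"
  assumes "bij p" and t: "\<And>i. t i ^ l = 1"
  shows "sing_poly j (\<chi> i. t i * x $ p i) = (\<Prod>i\<in>UNIV. t i ^ twist (i = j)) * sing_poly (p j) x"
proof -
  have factor: "factor b k (t i * y) = t i ^ twist b * factor b k y" for b k i y
    by (simp add: factor_def power_mult_distrib power_add power_mult t)
  have inj: "i = j \<longleftrightarrow> p i = p j" for i j
    using bij_is_inj[OF assms(1)] by (auto dest: injD)
  have "sing_poly j (\<chi> i. t i * x $ p i) = (\<Prod>i\<in>UNIV. t i ^ twist (i = j)) *
      (\<Sum>\<kappa>\<in>{\<kappa>. (\<Sum>i\<in>UNIV. \<kappa> i) = m}. \<Prod>i\<in>UNIV. factor (i = j) (\<kappa> i) (x $ p i))"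
    by (simp add: sing_poly_def factor prod.distrib sum_distrib_left)
  also have "(\<Sum>\<kappa>\<in>{\<kappa>. (\<Sum>i\<in>UNIV. \<kappa> i) = m}. \<Prod>i\<in>UNIV. factor (i = j) (\<kappa> i) (x $ p i))
     = sing_poly (p j) x"
    unfolding sing_poly_def
  proof (rule sum.reindex_bij_witness[where i = "\<lambda>\<kappa>. \<kappa> \<circ> p" and j = "\<lambda>\<kappa>. \<kappa> \<circ> inv p"])
    fix \<kappa> :: "'n \<Rightarrow> nat"
    show "\<kappa> \<circ> inv p \<circ> p = \<kappa>" "\<kappa> \<circ> p \<circ> inv p = \<kappa>"
      using assms(1) by (auto simp: fun_eq_iff bij_is_inj bij_is_surj surj_f_inv_f)
    show "\<kappa> \<circ> inv p \<in> {\<kappa>. sum \<kappa> UNIV = m}" if "\<kappa> \<in> {\<kappa>. sum \<kappa> UNIV = m}"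
      using that sum.reindex_bij_betw[OF bij_imp_bij_inv[OF assms(1)], of \<kappa>] by simp
    show "\<kappa> \<circ> p \<in> {\<kappa>. sum \<kappa> UNIV = m}" if "\<kappa> \<in> {\<kappa>. sum \<kappa> UNIV = m}"
      using that sum.reindex_bij_betw[OF assms(1), of \<kappa>] by simp
    have "(\<Prod>i\<in>UNIV. factor (i = p j) ((\<kappa> \<circ> inv p) i) (x $ i))
        = (\<Prod>i\<in>UNIV. factor (p i = p j) ((\<kappa> \<circ> inv p) (p i)) (x $ p i))"
      using prod.reindex_bij_betw[OF assms(1), of "\<lambda>i. factor (i = p j) ((\<kappa> \<circ> inv p) i) (x $ i)"]
      by simp
    then show "(\<Prod>i\<in>UNIV. factor (i = p j) ((\<kappa> \<circ> inv p) i) (x $ i))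
        = (\<Prod>i\<in>UNIV. factor (i = j) (\<kappa> i) (x $ p i))"
      using assms(1) by (simp add: bij_is_inj flip: inj)
  qed
  finally show ?thesis .
qed

lemma inv_monomial_map:
  assumes "bij p"
  shows "inv (monomial_map l p a) = (\<lambda>x. \<chi> k. inverse (omega l) ^ a (p k) * x $ p k)"
  by (rule inv_equality)
    (use assms in \<open>auto simp: monomial_map_def vec_eq_iff bij_is_inj bij_is_surj surj_f_inv_f
       simp flip: mult.assoc power_mult_distrib\<close>)

lemma inverse_omega_pow: "(inverse (omega l) ^ a) ^ l = 1"
proof -
  have "(inverse (omega l) ^ a) ^ l = inverse ((omega l ^ l) ^ a)"
    by (simp add: power_inverse mult.commute flip: power_mult)
  then show ?thesis
    by (simp add: omega_pow_l[OF l_pos])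
qed

lemma act_monomial_map:
  assumes "bij p"
  shows "act (monomial_map l p a) (sing_poly j) =
    fun_scale (\<Prod>i\<in>UNIV. (inverse (omega l) ^ a (p i)) ^ twist (i = j)) (sing_poly (p j))"
  unfolding act_def fun_scale_def inv_monomial_map[OF assms]
  by (rule ext, rule sing_poly_monomial[OF assms inverse_omega_pow])

lemma act_rot_funpow:
  "act (rot l i ^^ a) (sing_poly j) =
     fun_scale (inverse (omega l) ^ (a * twist (i = j))) (sing_poly j)"
proof -
  have "rot l i ^^ a = monomial_map l id (\<lambda>k. if k = i then a else 0)"
    by (auto simp: rot_funpow monomial_map_def fun_eq_iff vec_eq_iff)
  moreover have "(\<Prod>k\<in>UNIV. (inverse (omega l) ^ (if k = i then a else 0)) ^ twist (k = j))
      = inverse (omega l) ^ (a * twist (i = j))"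
    by (subst prod_UNIV_remove[of _ i]) (simp flip: power_mult)
  ultimately show ?thesis
    by (simp add: act_monomial_map)
qed

lemma act_sigma_refl:
  assumes "i \<noteq> k"
  shows "act (sigma_refl l i k a) (sing_poly j) =
    fun_scale (omega l ^ (a * twist (i = j)) * inverse (omega l) ^ (a * twist (k = j)))
      (sing_poly (Transposition.transpose i k j))"
proof -
  let ?p = "Transposition.transpose i k"
  let ?t = "\<lambda>c. if c = i then omega l ^ a else if c = k then inverse (omega l) ^ a else 1"
  have sigma: "sigma_refl l i k a x = (\<chi> c. ?t c * x $ ?p c)" for x
    using assms by (auto simp: sigma_refl_def vec_eq_iff transpose_def power_int_minus power_inverse)
  \<comment> \<open>A reflection is its own inverse, so \<open>act\<close> substitutes the
    reflection itself.\<close>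
  have "sigma_refl l i k a (sigma_refl l i k a x) = x" for x
    using assms by (auto simp: sigma transpose_def vec_eq_iff simp flip: mult.assoc power_mult_distrib)
  then have "inv (sigma_refl l i k a) = sigma_refl l i k a"
    by (intro inv_equality)
  moreover have "?t c ^ l = 1" for c
    using inverse_omega_pow[of a] omega_pow_l[OF l_pos]
    by (simp add: mult.commute[of a] flip: power_mult) (simp add: power_mult)
  moreover have "(\<Prod>c\<in>UNIV. ?t c ^ twist (c = j))
     = omega l ^ (a * twist (i = j)) * inverse (omega l) ^ (a * twist (k = j))"
    using assms by (subst prod_UNIV_remove[of _ i], subst prod.remove[of _ k]) (auto simp flip: power_mult)
  ultimately show ?thesis
    using sing_poly_monomial[of ?p ?t j] by (simp add: act_def fun_scale_def sigma fun_eq_iff)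
qed

section \<open>Dunkl operators\<close>

text \<open>The product rule applied to a power of \<open>x $ i\<close> and a series coefficient;
  multiplying by \<open>x $ i\<close> clears the denominators.\<close>

lemma partial_deriv_sing_poly:
  fixes x :: "complex^'n::finite"
  assumes nz: "\<And>k. x $ k \<noteq> 0"
  shows "x $ i * partial_deriv i (sing_poly j) x =
    (\<Prod>k\<in>UNIV. x $ k ^ (l * m + twist (k = j))) *
    (of_nat (l * m + twist (i = j)) * gen_series \<nu> (\<lambda>k. 1 / x $ k ^ l) j $ m
     - of_nat l * (fps_X * fps_deriv (binomial_series (if i = j then \<nu> - 1 else \<nu>) (1 / x $ i ^ l)) *
         (\<Prod>k\<in>UNIV - {i}. binomial_series (if k = j then \<nu> - 1 else \<nu>) (1 / x $ k ^ l))) $ m)"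
proof -
  define b where "b = (if i = j then \<nu> - 1 else \<nu>)"
  define e where "e = l * m + twist (i = j)"
  define A where "A = (\<Prod>k\<in>UNIV - {i}. x $ k ^ (l * m + twist (k = j)))"
  define R where "R = (\<Prod>k\<in>UNIV - {i}. binomial_series (if k = j then \<nu> - 1 else \<nu>) (1 / x $ k ^ l))"
  \<comment> \<open>The restriction to the line in direction \<open>i\<close>. It is only compared
    with \<open>sing_poly j\<close> for \<open>t \<noteq> 0\<close>, an open set containing
    \<open>x $ i\<close>, which suffices for the derivative.\<close>
  define h where "h t = t ^ e * (A * (binomial_series b (1 / t ^ l) * R) $ m)" for t
  define D where "D = (fps_X * fps_deriv (binomial_series b (1 / x $ i ^ l)) * R) $ m"
  have pow: "((\<lambda>t. t ^ e) has_field_derivative of_nat e / x $ i * x $ i ^ e) (at (x $ i))"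
    by (rule DERIV_cong[OF DERIV_power[OF DERIV_ident]]) (use nz in \<open>cases e; simp\<close>)
  have h: "(h has_field_derivative
     of_nat e / x $ i * x $ i ^ e * (A * (binomial_series b (1 / x $ i ^ l) * R) $ m)
     + A * (- of_nat l / x $ i * D) * x $ i ^ e) (at (x $ i))"
    unfolding h_def D_def
    by (rule DERIV_mult[OF pow DERIV_cmult[OF has_field_derivative_binomial_series[OF nz]]])
  have eq: "h t = sing_poly j (\<chi> k. if k = i then t else x $ k)" if "t \<noteq> 0" for t
  proof -
    let ?x = "\<chi> k. if k = i then t else x $ k"
    have "(\<Prod>k\<in>UNIV - {i}. ?x $ k ^ (l * m + twist (k = j))) = A"
      unfolding A_def by (rule prod.cong) auto
    moreover have "(\<Prod>k\<in>UNIV - {i}. binomial_series (if k = j then \<nu> - 1 else \<nu>) (1 / ?x $ k ^ l)) = R"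
      unfolding R_def by (rule prod.cong) auto
    moreover have "?x $ k \<noteq> 0" for k
      using nz that by simp
    ultimately show ?thesis
      unfolding h_def b_def e_def
      by (subst sing_poly_eq) (simp_all add: gen_series_def prod_UNIV_remove[of _ i] mult_ac)
  qed
  have "deriv (\<lambda>t. sing_poly j (\<chi> k. if k = i then t else x $ k)) (x $ i)
    = of_nat e / x $ i * x $ i ^ e * (A * (binomial_series b (1 / x $ i ^ l) * R) $ m)
     + A * (- of_nat l / x $ i * D) * x $ i ^ e"
    by (rule DERIV_imp_deriv, rule has_field_derivative_transform_within_open[OF h, of "- {0}"])
      (use nz eq in auto)
  then have "x $ i * partial_deriv i (sing_poly j) x = x $ i ^ e * A *
     (of_nat e * (binomial_series b (1 / x $ i ^ l) * R) $ m - of_nat l * D)"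
    using nz[of i] by (simp add: partial_deriv_def field_simps)
  then show ?thesis
    unfolding D_def e_def A_def R_def b_def gen_series_def prod_UNIV_remove[of _ i] .
qed

text \<open>Only the residue \<open>r\<close> of \<open>- t\<close> modulo \<open>l\<close> can
  contribute. If \<open>r = 0\<close> it lies outside the range of summation, in accordance with the
  value 0 of \<open>c_ext\<close>.\<close>

lemma sum_c_ext:
  "(\<Sum>b=1..l-1. c b * (if l dvd b + t then of_nat l else 0)) = of_nat l * c_ext l c (- int t)"
proof -
  define r where "r = nat (- int t mod int l)"
  have r: "int r = - int t mod int l"
    using l_pos by (simp add: r_def)
  have "r < l"
    using l_pos by (simp add: r_def nat_less_iff)
  have iff: "l dvd b + t \<longleftrightarrow> b = r" if "b < l" for b
  proof -
    have "l dvd b + t \<longleftrightarrow> int l dvd int b - (- int t)"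
      by (simp flip: int_dvd_int_iff)
    also have "\<dots> \<longleftrightarrow> int b mod int l = - int t mod int l"
      by (simp add: mod_eq_dvd_iff)
    also have "\<dots> \<longleftrightarrow> b = r"
      using that by (simp flip: r)
    finally show ?thesis .
  qed
  have "(\<Sum>b=1..l-1. c b * (if l dvd b + t then of_nat l else 0))
      = (\<Sum>b=1..l-1. if b = r then of_nat l * c b else 0)"
    by (rule sum.cong[OF refl]) (use iff in auto)
  also have "\<dots> = of_nat l * c_ext l c (- int t)"
    using \<open>r < l\<close> by (auto simp: c_ext_def r_def[symmetric] simp flip: r)
  finally show ?thesis .
qed

text \<open>\<open>sing_poly j\<close> is an eigenvector of the rotations, so the inner sum is a
  character sum that selects \<open>b\<close> congruent to \<open>- twist (i = j)\<close>.\<close>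

lemma rot_part_sing_poly:
  fixes x :: "complex^'n::finite"
  shows
  "(\<Sum>b=1..l-1. c b *
     (\<Sum>a<l. omega l powi (- int (a * b)) / x $ i * act (rot l i ^^ a) (sing_poly j) x))
   = of_nat l * c_ext l c (- int (twist (i = j))) * sing_poly j x / x $ i"
proof -
  have "(\<Sum>a<l. omega l powi (- int (a * b)) / x $ i * act (rot l i ^^ a) (sing_poly j) x)
      = (if l dvd b + twist (i = j) then of_nat l else 0) * (sing_poly j x / x $ i)" for b
  proof -
    have "omega l powi (- int (a * b)) / x $ i * act (rot l i ^^ a) (sing_poly j) x
      = inverse (omega l) ^ (a * (b + twist (i = j))) * (sing_poly j x / x $ i)" for a
      unfolding act_rot_funpow fun_scale_def power_int_minus power_int_of_nat
      by (simp add: power_add power_inverse add_mult_distrib2 divide_inverse mult_ac)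
    then show ?thesis
      by (simp only: sum_omega_powers_inverse[OF l_pos] flip: sum_distrib_right)
  qed
  then have "(\<Sum>b=1..l-1. c b *
     (\<Sum>a<l. omega l powi (- int (a * b)) / x $ i * act (rot l i ^^ a) (sing_poly j) x))
   = (\<Sum>b=1..l-1. c b * (if l dvd b + twist (i = j) then of_nat l else 0)) * (sing_poly j x / x $ i)"
    unfolding sum_distrib_right by (simp only: mult.assoc)
  then show ?thesis
    unfolding sum_c_ext by simp
qed

section \<open>The reflection part of the Dunkl operators\<close>

lemma omega_twist_same: "omega l ^ (a * s) * inverse (omega l) ^ (a * (l - q + s)) = omega l ^ (a * q)"
proof -
  \<comment> \<open>The two twists differ by \<open>q\<close> modulo \<open>l\<close>.\<close>
  have "q + (l - q + s) = l + s"
    using q_less by simp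
  then have "a * q + a * (l - q + s) = l * a + a * s"
    by (metis add_mult_distrib2 mult.commute)
  then have "omega l ^ (a * q) * omega l ^ (a * (l - q + s)) = omega l ^ (l * a + a * s)"
    by (simp flip: power_add)
  also have "\<dots> = omega l ^ (a * s)"
    by (simp add: power_add power_mult omega_pow_l[OF l_pos])
  finally show ?thesis
    by (simp add: power_inverse field_simps)
qed

lemma omega_twist_other: "omega l ^ (a * (l - q + s)) * inverse (omega l) ^ (a * s) = omega l ^ (a * (l - q))"
  by (simp add: add_mult_distrib2 power_add power_inverse)

text \<open>Otherwise the two coordinates would differ by an \<open>l\<close>-th root of unity, and
  \<open>x\<close> would lie on a reflection hyperplane.\<close>

lemma regular_power_ne:
  fixes x :: "complex^'n::finite"
  assumes "regular_point l x" and "i \<noteq> k"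
  shows "x $ i ^ l \<noteq> x $ k ^ l"
  using eq_omega_mult_if_power_eq[OF l_pos, of "x $ i" "x $ k"] assms
  unfolding regular_point_def by blast

text \<open>The prefactors for \<open>i\<close> and \<open>k\<close> differ by moving
  \<open>l - q\<close> from the exponent of one coordinate to that of the other. The powers left by
  the sum over roots of unity compensate this, so only series coefficients remain to be
  compared.\<close>

lemma prefactor_exchange:
  fixes x :: "complex^'n::finite"
  assumes "i \<noteq> k"
  shows "x $ i ^ q * x $ k ^ (l - q) * (\<Prod>c\<in>UNIV. x $ c ^ (l * m + twist (c = k)))
     = x $ i ^ l * (\<Prod>c\<in>UNIV. x $ c ^ (l * m + twist (c = i)))"
proof -
  have split: "(\<Prod>c\<in>UNIV. x $ c ^ (l * m + twist (c = j)))
     = x $ i ^ (l * m + twist (i = j)) * (x $ k ^ (l * m + twist (k = j)) *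
        (\<Prod>c\<in>UNIV - {i} - {k}. x $ c ^ (l * m + twist False)))" if "j \<in> {i, k}" for j
  proof -
    have "(\<Prod>c\<in>UNIV - {i} - {k}. x $ c ^ (l * m + twist (c = j)))
        = (\<Prod>c\<in>UNIV - {i} - {k}. x $ c ^ (l * m + twist False))"
      using that by (intro prod.cong) auto
    then show ?thesis
      using assms by (subst prod_UNIV_remove[of _ i], subst prod.remove[of _ k]) auto
  qed
  have i: "x $ i ^ q * x $ i ^ (l * m + twist False) = x $ i ^ l * x $ i ^ (l * m + twist True)"
    using q_less by (simp add: twist_def add_ac flip: power_add)
  have k: "x $ k ^ (l - q) * x $ k ^ (l * m + twist True) = x $ k ^ (l * m + twist False)"
    by (simp add: twist_def add_ac flip: power_add)
  have reorder: "a * b * (c * (d * Q)) = (a * c) * (b * d) * Q" for a b c d Q :: complex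
    by (simp only: mult_ac)
  have "x $ i ^ q * x $ k ^ (l - q) * (x $ i ^ (l * m + twist False) * (x $ k ^ (l * m + twist True) * Q))
      = x $ i ^ l * (x $ i ^ (l * m + twist True) * (x $ k ^ (l * m + twist False) * Q))" for Q
    by (subst reorder, simp only: i k, simp only: mult.assoc)
  then show ?thesis
    using split[of i] split[of k] assms by (simp only: insert_iff refl simp_thms if_True) auto
qed

lemma reflection_sum_same:
  fixes x :: "complex^'n::finite"
  assumes reg: "regular_point l x" and "i \<noteq> k"
  defines "c \<equiv> \<lambda>k. 1 / x $ k ^ l"
  shows "x $ i * (\<Sum>a<l. 1 / (x $ i - omega l ^ a * x $ k) *
      (sing_poly i x - act (sigma_refl l i k a) (sing_poly i) x))
    = of_nat l * (\<Prod>c\<in>UNIV. x $ c ^ (l * m + twist (c = i))) *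
      (c k / (c k - c i) * (gen_series \<nu> c i $ m - gen_series \<nu> c k $ m))"
proof -
  have nz: "x $ k \<noteq> 0" for k
    using reg by (simp add: regular_point_def)
  note ne = regular_power_ne[OF reg \<open>i \<noteq> k\<close>]
  define P where "P j = (\<Prod>c\<in>UNIV. x $ c ^ (l * m + twist (c = j)))" for j
  define g where "g j = gen_series \<nu> c j $ m" for j
  have f: "sing_poly j x = P j * g j" for j
    unfolding P_def g_def c_def by (rule sing_poly_eq[OF nz])
  have act: "act (sigma_refl l i k a) (sing_poly i) x = omega l ^ (a * q) * sing_poly k x" for a
    using act_sigma_refl[OF \<open>i \<noteq> k\<close>, of a i] \<open>i \<noteq> k\<close> omega_twist_same[of a]
    by (simp add: fun_scale_def twist_def)
  \<comment> \<open>Writing 1 as \<open>omega l ^ (a * l)\<close> makes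
    \<open>sum_omega_power_div\<close> apply to both sums, with \<open>r = l\<close> and
    \<open>r = q\<close>.\<close>
  have "(\<Sum>a<l. 1 / (x $ i - omega l ^ a * x $ k) *
      (sing_poly i x - act (sigma_refl l i k a) (sing_poly i) x))
    = (\<Sum>a<l. omega l ^ (a * l) / (x $ i - omega l ^ a * x $ k)) * sing_poly i x
    - (\<Sum>a<l. omega l ^ (a * q) / (x $ i - omega l ^ a * x $ k)) * sing_poly k x"
    by (simp add: act sum_distrib_right right_diff_distrib omega_pow_l[OF l_pos] power_mult
        mult.commute[of _ l] flip: sum_subtractf)
  also have "\<dots> = of_nat l * (x $ i ^ (l - 1) * sing_poly i x
     - x $ i ^ (q - 1) * x $ k ^ (l - q) * sing_poly k x) / (x $ i ^ l - x $ k ^ l)"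
    using sum_omega_power_div[OF _ _ ne] l_pos q_ge q_less
    by (simp add: diff_divide_distrib right_diff_distrib mult.assoc)
  finally have "x $ i * (\<Sum>a<l. 1 / (x $ i - omega l ^ a * x $ k) *
      (sing_poly i x - act (sigma_refl l i k a) (sing_poly i) x))
    = of_nat l * ((x $ i * x $ i ^ (l - 1)) * sing_poly i x
     - (x $ i * x $ i ^ (q - 1)) * x $ k ^ (l - q) * sing_poly k x) / (x $ i ^ l - x $ k ^ l)"
    by (simp add: algebra_simps)
  also have "\<dots> = of_nat l * (x $ i ^ l * P i * g i
     - x $ i ^ q * x $ k ^ (l - q) * P k * g k) / (x $ i ^ l - x $ k ^ l)"
    using l_pos q_ge by (simp add: f mult_ac flip: power_Suc)
  also have "\<dots> = of_nat l * P i * (x $ i ^ l / (x $ i ^ l - x $ k ^ l) * (g i - g k))"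
    unfolding P_def prefactor_exchange[OF \<open>i \<noteq> k\<close>] by (simp add: algebra_simps)
  also have "x $ i ^ l / (x $ i ^ l - x $ k ^ l) = c k / (c k - c i)"
    using nz ne by (simp add: c_def field_simps)
  finally show ?thesis
    by (simp add: P_def g_def)
qed

lemma reflection_sum_other:
  fixes x :: "complex^'n::finite"
  assumes reg: "regular_point l x" and "i \<noteq> j"
  defines "c \<equiv> \<lambda>k. 1 / x $ k ^ l"
  shows "x $ i * (\<Sum>a<l. 1 / (x $ i - omega l ^ a * x $ j) *
      (sing_poly j x - act (sigma_refl l i j a) (sing_poly j) x))
    = of_nat l * (\<Prod>c\<in>UNIV. x $ c ^ (l * m + twist (c = j))) *
      (gen_series \<nu> c j $ m + c i / (c j - c i) * (gen_series \<nu> c j $ m - gen_series \<nu> c i $ m))"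
proof -
  have nz: "x $ k \<noteq> 0" for k
    using reg by (simp add: regular_point_def)
  note ne = regular_power_ne[OF reg \<open>i \<noteq> j\<close>]
  define P where "P j = (\<Prod>c\<in>UNIV. x $ c ^ (l * m + twist (c = j)))" for j
  define g where "g j = gen_series \<nu> c j $ m" for j
  have f: "sing_poly j x = P j * g j" for j
    unfolding P_def g_def c_def by (rule sing_poly_eq[OF nz])
  have act: "act (sigma_refl l i j a) (sing_poly j) x = omega l ^ (a * (l - q)) * sing_poly i x" for a
    using act_sigma_refl[OF \<open>i \<noteq> j\<close>, of a j] \<open>i \<noteq> j\<close> omega_twist_other[of a]
    by (simp add: fun_scale_def twist_def)
  have "(\<Sum>a<l. 1 / (x $ i - omega l ^ a * x $ j) *
      (sing_poly j x - act (sigma_refl l i j a) (sing_poly j) x))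
    = (\<Sum>a<l. omega l ^ (a * l) / (x $ i - omega l ^ a * x $ j)) * sing_poly j x
    - (\<Sum>a<l. omega l ^ (a * (l - q)) / (x $ i - omega l ^ a * x $ j)) * sing_poly i x"
    by (simp add: act sum_distrib_right right_diff_distrib omega_pow_l[OF l_pos] power_mult
        mult.commute[of _ l] flip: sum_subtractf)
  also have "\<dots> = of_nat l * (x $ i ^ (l - 1) * sing_poly j x
     - x $ i ^ (l - q - 1) * x $ j ^ q * sing_poly i x) / (x $ i ^ l - x $ j ^ l)"
    using sum_omega_power_div[OF _ _ ne, of l] sum_omega_power_div[OF _ _ ne, of "l - q"] l_pos q_ge q_less
    by (simp add: diff_divide_distrib right_diff_distrib mult.assoc)
  finally have "x $ i * (\<Sum>a<l. 1 / (x $ i - omega l ^ a * x $ j) *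
      (sing_poly j x - act (sigma_refl l i j a) (sing_poly j) x))
    = of_nat l * ((x $ i * x $ i ^ (l - 1)) * sing_poly j x
     - (x $ i * x $ i ^ (l - q - 1)) * x $ j ^ q * sing_poly i x) / (x $ i ^ l - x $ j ^ l)"
    by (simp add: algebra_simps)
  also have "\<dots> = of_nat l * (x $ i ^ l * P j * g j
     - x $ j ^ q * x $ i ^ (l - q) * P i * g i) / (x $ i ^ l - x $ j ^ l)"
  proof -
    have "x $ i * x $ i ^ (l - 1) = x $ i ^ l" "x $ i * x $ i ^ (l - q - 1) = x $ i ^ (l - q)"
      using l_pos q_less by (simp_all add: Suc_diff_Suc flip: power_Suc)
    then show ?thesis
      by (simp only: f mult_ac)
  qed
  also have "\<dots> = of_nat l * P j * ((x $ i ^ l * g j - x $ j ^ l * g i) / (x $ i ^ l - x $ j ^ l))"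
    unfolding P_def prefactor_exchange[OF \<open>i \<noteq> j\<close>[symmetric]] by (simp add: algebra_simps)
  \<comment> \<open>The extra \<open>g j\<close> will cancel against the derivative of the
    prefactor, whose exponent at \<open>x $ i\<close> is \<open>l \<nu>\<close>.\<close>
  also have "(x $ i ^ l * g j - x $ j ^ l * g i) / (x $ i ^ l - x $ j ^ l)
      = g j + x $ j ^ l / (x $ i ^ l - x $ j ^ l) * (g j - g i)"
    using ne by (simp add: field_simps)
  also have "x $ j ^ l / (x $ i ^ l - x $ j ^ l) = c i / (c j - c i)"
    using nz ne by (simp add: c_def field_simps)
  finally show ?thesis
    by (simp add: P_def g_def)
qed

lemma act_sigma_refl_fixed:
  assumes "i \<noteq> k" and "j \<noteq> i" and "j \<noteq> k"
  shows "act (sigma_refl l i k a) (sing_poly j) = sing_poly j"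
  using act_sigma_refl[OF assms(1), of a j] assms
  by (simp add: fun_scale_def fun_eq_iff power_inverse)

text \<open>The hypotheses on \<open>c\<close> enter here: the twists are \<open>s\<close> and
  \<open>l - q + s\<close>, and the latter is congruent to \<open>s - q\<close> modulo
  \<open>l\<close>.\<close>

lemma twist_c_ext:
  assumes "c_ext l c (int q - int s) = 0" and "c_ext l c (- int s) = of_nat s / of_nat l"
  shows "of_nat l * c_ext l c (- int (twist b)) = (if b then of_nat s else 0)"
proof -
  have "- int (l - q + s) = (int q - int s) - int l"
    using q_less by (simp add: of_nat_diff)
  then have "- int (l - q + s) mod int l = (int q - int s) mod int l"
    by (metis minus_mod_self2)
  then have "c_ext l c (- int (l - q + s)) = 0"
    using assms(1) by (simp only: c_ext_def)
  then show ?thesis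
    using assms(2) l_pos by (simp add: twist_def del: of_nat_add)
qed

text \<open>After multiplication by \<open>x $ i\<close>, all parts share the prefactor
  \<open>P\<close>. For \<open>i = j\<close> the rotation part cancels the \<open>s\<close> of
  \<open>twist\<close>, leaving \<open>gen_series_deriv_same\<close>. For
  \<open>i \<noteq> j\<close> the rotation part vanishes and only reflections exchanging
  \<open>i\<close> and \<open>j\<close> contribute, leaving
  \<open>gen_series_deriv_other\<close>.\<close>

lemma dunkl_sing_poly:
  fixes i j :: "'n::finite"
  assumes "c_ext l c (int q - int s) = 0" and "c_ext l c (- int s) = of_nat s / of_nat l"
  shows "dunkl_vanishes l \<nu> c i (sing_poly j)"
  unfolding dunkl_vanishes_def
proof (intro allI impI)
  fix x :: "complex^'n"
  assume reg: "regular_point l x"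
  then have nz: "x $ k \<noteq> 0" for k
    by (simp add: regular_point_def)
  define y where "y k = 1 / x $ k ^ l" for k
  have y_ne: "y k \<noteq> y k'" if "k \<noteq> k'" for k k'
    using regular_power_ne[OF reg that] by (simp add: y_def)
  define P where "P = (\<Prod>k\<in>UNIV. x $ k ^ (l * m + twist (k = j)))"
  define g where "g k = gen_series \<nu> y k $ m" for k
  define D where "D = (fps_X * fps_deriv (binomial_series (if i = j then \<nu> - 1 else \<nu>) (y i)) *
         (\<Prod>k\<in>UNIV - {i}. binomial_series (if k = j then \<nu> - 1 else \<nu>) (y k))) $ m"
  define S where "S k = (\<Sum>a<l. 1 / (x $ i - omega l ^ a * x $ k) *
         (sing_poly j x - act (sigma_refl l i k a) (sing_poly j) x))" for k
  have f: "sing_poly j x = P * g j"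
    unfolding P_def g_def y_def by (rule sing_poly_eq[OF nz])
  have deriv: "x $ i * partial_deriv i (sing_poly j) x
      = P * (of_nat (l * m + twist (i = j)) * g j - of_nat l * D)"
    unfolding P_def g_def D_def y_def by (rule partial_deriv_sing_poly[OF nz])
  have rot: "(\<Sum>b=1..l-1. c b *
         (\<Sum>a<l. omega l powi (- int (a * b)) / x $ i * act (rot l i ^^ a) (sing_poly j) x))
      = (if i = j then of_nat s else 0) * (P * g j) / x $ i"
    unfolding rot_part_sing_poly twist_c_ext[OF assms] f ..
  have dunkl: "x $ i * dunkl l \<nu> c i (sing_poly j) x
      = P * (of_nat (l * m + twist (i = j)) * g j - of_nat l * D)
        - \<nu> * (\<Sum>k\<in>UNIV - {i}. x $ i * S k) - (if i = j then of_nat s else 0) * (P * g j)"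
  proof -
    have "(\<Sum>a<l. \<Sum>k\<in>UNIV - {i}. 1 / (x $ i - omega l ^ a * x $ k) *
         (sing_poly j x - act (sigma_refl l i k a) (sing_poly j) x)) = (\<Sum>k\<in>UNIV - {i}. S k)"
      unfolding S_def by (rule sum.swap)
    then show ?thesis
      unfolding dunkl_def rot deriv[symmetric]
      using nz[of i] by (simp add: right_diff_distrib sum_distrib_left mult.left_commute)
  qed
  have "x $ i * dunkl l \<nu> c i (sing_poly j) x = 0"
  proof (cases "i = j")
    case True
    have D: "of_nat m * g i - D = \<nu> * (\<Sum>k\<in>UNIV - {i}. y k / (y k - y i) * (g i - g k))"
    proof -
      have "(\<Prod>k\<in>UNIV - {i}. binomial_series (if k = j then \<nu> - 1 else \<nu>) (y k))
          = (\<Prod>k\<in>UNIV - {i}. binomial_series \<nu> (y k))"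
        using True by (intro prod.cong) auto
      then show ?thesis
        using gen_series_deriv_same[of i y m \<nu>] y_ne True by (simp add: g_def D_def)
    qed
    have "(\<Sum>k\<in>UNIV - {i}. x $ i * S k)
        = of_nat l * P * (\<Sum>k\<in>UNIV - {i}. y k / (y k - y i) * (g i - g k))"
      unfolding sum_distrib_left
    proof (rule sum.cong[OF refl])
      fix k assume "k \<in> UNIV - {i}"
      then show "x $ i * S k = of_nat l * P * (y k / (y k - y i) * (g i - g k))"
        using reflection_sum_same[OF reg, of i k] True unfolding S_def P_def g_def y_def by auto
    qed
    then have "\<nu> * (\<Sum>k\<in>UNIV - {i}. x $ i * S k) = of_nat l * P * (of_nat m * g i - D)"
      unfolding D by simp
    then show ?thesis
      unfolding dunkl using True by (simp add: twist_def algebra_simps)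
  next
    case False
    define T where "T = y i / (y j - y i) * (g j - g i)"
    have "- D = \<nu> * T"
      using gen_series_deriv_other[OF False y_ne[OF False], of \<nu> m] False by (simp add: g_def D_def T_def)
    then have D: "D = - (\<nu> * T)"
      by (simp add: minus_equation_iff[of D])
    have "S k = 0" if "k \<in> UNIV - {i} - {j}" for k
    proof -
      have "act (sigma_refl l i k a) (sing_poly j) = sing_poly j" for a
        using that False by (intro act_sigma_refl_fixed) auto
      then show ?thesis
        by (simp add: S_def)
    qed
    then have "(\<Sum>k\<in>UNIV - {i}. x $ i * S k) = x $ i * S j"
      using False by (subst sum.remove[of _ j]) auto
    also have "\<dots> = of_nat l * P * (g j + T)"
      using reflection_sum_other[OF reg False] unfolding S_def P_def g_def y_def T_def .
    finally have "\<nu> * (\<Sum>k\<in>UNIV - {i}. x $ i * S k) = P * (of_nat l * \<nu> * g j - of_nat l * D)"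
      by (simp add: D algebra_simps)
    then show ?thesis
      unfolding dunkl l_nu using False by (simp add: twist_def)
  qed
  then show "dunkl l \<nu> c i (sing_poly j) x = 0"
    using nz[of i] by simp
qed

section \<open>Irreducibility\<close>

lemma sing_poly_nonzero: "sing_poly (j::'n::finite) \<noteq> 0"
proof
  assume "sing_poly j = 0"
  then have "sing_poly j (\<chi> i. 1) = 0"
    by simp
  moreover have "sing_poly j (\<chi> i. 1) = gen_series \<nu> (\<lambda>i. 1) j $ m"
    by (subst sing_poly_eq) simp_all
  moreover have "gen_series \<nu> (\<lambda>i::'n. 1) j $ m \<noteq> 0"
  proof (rule gen_series_one_nth_ne_0)
    have "0 < (real l - real q + real s) / real l"
      using q_less by (intro divide_pos_pos) auto
    then show "0 < real m + (real l - real q + real s) / real l"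
      and "real m + (real l - real q + real s) / real l - 1 > real m - 1"
      by simp_all
    show "\<nu> = complex_of_real (real m + (real l - real q + real s) / real l)"
      by (simp add: nu)
  qed
  ultimately show False
    by simp
qed

text \<open>
  The \<open>f\<^sub>k\<close> with \<open>k \<noteq> j\<close> are all eigenvectors of \<open>s\<^sub>j\<close> for one eigenvalue, and \<open>f\<^sub>j\<close> is one for
  another; hence \<open>s\<^sub>j\<close> minus the first eigenvalue isolates the component along \<open>f\<^sub>j\<close>.
\<close>

definition isolate :: "'n::finite \<Rightarrow> (complex^'n \<Rightarrow> complex) \<Rightarrow> complex^'n \<Rightarrow> complex" where
  "isolate j u = act (rot l j) u - fun_scale (inverse (omega l) ^ (l - q + s)) u"

definition eigen_gap :: complex where
  "eigen_gap = inverse (omega l) ^ s - inverse (omega l) ^ (l - q + s)"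

text \<open>The two eigenvalues have ratio \<open>omega l ^ (l - q)\<close>, which is not 1 because
  0 < l - q < l.\<close>

lemma eigen_gap_nonzero: "eigen_gap \<noteq> 0"
proof
  assume "eigen_gap = 0"
  then have "omega l ^ (l - q) = 1"
    by (simp add: eigen_gap_def power_add power_inverse)
  then show False
    using omega_pow_eq_1_iff[OF l_pos] q_ge q_less by (auto dest!: dvd_imp_le)
qed

lemma isolate_combination:
  fixes j :: "'n::finite"
  shows "isolate j (\<Sum>k\<in>UNIV. fun_scale (\<alpha> k) (sing_poly k)) = fun_scale (\<alpha> j * eigen_gap) (sing_poly j)"
proof -
  have rot: "act (rot l j) (sing_poly k) = fun_scale (inverse (omega l) ^ twist (j = k)) (sing_poly k)" for k
    using act_rot_funpow[where i = j and a = 1 and j = k] by simp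
  have "isolate j (\<Sum>k\<in>UNIV. fun_scale (\<alpha> k) (sing_poly k))
      = (\<Sum>k\<in>UNIV. fun_scale (\<alpha> k * (inverse (omega l) ^ twist (j = k) - inverse (omega l) ^ (l - q + s))) (sing_poly k))"
    unfolding isolate_def act_sum act_scale rot cfun.scale_sum_right sum_subtractf[symmetric]
    by (rule sum.cong[OF refl]) (simp add: fun_scale_def fun_eq_iff algebra_simps)
  also have "\<dots> = (\<Sum>k\<in>UNIV. if k = j then fun_scale (\<alpha> j * eigen_gap) (sing_poly j) else 0)"
    by (rule sum.cong[OF refl]) (auto simp: eigen_gap_def twist_def)
  finally show ?thesis
    by simp
qed

section \<open>Linear independence, span and dimension\<close>

lemma combination_eq_0_iff:
  fixes \<alpha> :: "'n::finite \<Rightarrow> complex"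
  shows "(\<Sum>k\<in>UNIV. fun_scale (\<alpha> k) (sing_poly k)) = 0 \<longleftrightarrow> (\<forall>j. \<alpha> j = 0)"
proof (intro iffI allI)
  fix j
  assume 0: "(\<Sum>k\<in>UNIV. fun_scale (\<alpha> k) (sing_poly k)) = 0"
  \<comment> \<open>Applying \<open>isolate j\<close> to the vanishing combination leaves only the
    component along \<open>sing_poly j\<close>.\<close>
  have "fun_scale (\<alpha> j * eigen_gap) (sing_poly j) = isolate j 0"
    unfolding isolate_combination[symmetric] 0 ..
  also have "\<dots> = 0"
    by (simp add: isolate_def act_def fun_scale_def fun_eq_iff)
  finally show "\<alpha> j = 0"
    using sing_poly_nonzero[of j] eigen_gap_nonzero by simp
qed simp

text \<open>This turns sums over the set \<open>range sing_poly\<close> into sums over indices. Two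
  equal members would give a nontrivial vanishing combination.\<close>

lemma inj_sing_poly: "inj (sing_poly :: 'n::finite \<Rightarrow> _)"
proof (rule injI, rule ccontr)
  fix i j :: 'n
  assume eq: "sing_poly i = sing_poly j" and "i \<noteq> j"
  have "fun_scale (if k = i then 1 else if k = j then - 1 else 0) (sing_poly k)
      = (if k = i then sing_poly i else 0) - (if k = j then sing_poly j else 0)" for k
    using \<open>i \<noteq> j\<close> by (auto simp: fun_scale_def fun_eq_iff)
  then have "(\<Sum>k\<in>UNIV. fun_scale (if k = i then 1 else if k = j then - 1 else 0) (sing_poly k))
      = sing_poly i - sing_poly j"
    by (simp add: sum_subtractf)
  also have "\<dots> = 0"
    using eq by simp
  finally show False
    unfolding combination_eq_0_iff by (metis zero_neq_one)
qed

lemma span_sing_poly: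
  "cfun.span (range (sing_poly :: 'n::finite \<Rightarrow> _)) = range (\<lambda>\<alpha>. \<Sum>k\<in>UNIV. fun_scale (\<alpha> k) (sing_poly k))"
proof (intro equalityI subsetI)
  fix u assume "u \<in> cfun.span (range (sing_poly :: 'n \<Rightarrow> _))"
  then obtain \<beta> where "u = (\<Sum>v\<in>range (sing_poly :: 'n \<Rightarrow> _). fun_scale (\<beta> v) v)"
    using cfun.span_finite[of "range (sing_poly :: 'n \<Rightarrow> _)"] by auto
  then show "u \<in> range (\<lambda>\<alpha>. \<Sum>k\<in>UNIV. fun_scale (\<alpha> k) (sing_poly k))"
    by (auto simp: sum.reindex[OF inj_sing_poly])
next
  fix u assume "u \<in> range (\<lambda>\<alpha>. \<Sum>k\<in>UNIV. fun_scale (\<alpha> k) (sing_poly (k::'n)))"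
  then obtain \<alpha> where "u = (\<Sum>k\<in>UNIV. fun_scale (\<alpha> k) (sing_poly (k::'n)))"
    by blast
  then show "u \<in> cfun.span (range (sing_poly :: 'n \<Rightarrow> _))"
    by (simp add: cfun.span_sum cfun.span_scale cfun.span_base)
qed

lemma dim_span_sing_poly: "cfun.dim (cfun.span (range (sing_poly :: 'n::finite \<Rightarrow> _))) = CARD('n)"
proof -
  have "cfun.independent (range (sing_poly :: 'n \<Rightarrow> _))"
  proof
    assume "cfun.dependent (range (sing_poly :: 'n \<Rightarrow> _))"
    then obtain \<beta> where "\<exists>v\<in>range (sing_poly :: 'n \<Rightarrow> _). \<beta> v \<noteq> 0"
      and "(\<Sum>v\<in>range (sing_poly :: 'n \<Rightarrow> _). fun_scale (\<beta> v) v) = 0"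
      using cfun.dependent_finite[of "range (sing_poly :: 'n \<Rightarrow> _)"] by auto
    then show False
      using combination_eq_0_iff[of "\<lambda>k. \<beta> (sing_poly k)"]
      by (auto simp: sum.reindex[OF inj_sing_poly])
  qed
  then show ?thesis
    by (subst cfun.dim_span_eq_card_independent) (simp_all add: card_image[OF inj_sing_poly])
qed

text \<open>A nonzero vector of a stable subspace has a nonzero coefficient at some
  \<open>j\<close>; \<open>isolate j\<close> extracts \<open>sing_poly j\<close>, and transpositions
  carry it to every other \<open>sing_poly k\<close>.\<close>

lemma irreducible_span_sing_poly:
  "irreducible_rep (refl_group l) (cfun.span (range (sing_poly :: 'n::finite \<Rightarrow> _)))"
  unfolding irreducible_rep_def
proof (intro conjI allI impI)
  let ?V = "cfun.span (range (sing_poly :: 'n \<Rightarrow> _))"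
  show "cfun.subspace ?V"
    by (rule cfun.subspace_span)
  show "stable (refl_group l) ?V"
    unfolding stable_def
  proof (intro ballI)
    fix w :: "complex^'n \<Rightarrow> complex^'n" and u
    assume "w \<in> refl_group l" and "u \<in> ?V"
    then obtain p a \<alpha> where w: "bij p" "w = monomial_map l p a"
      and u: "u = (\<Sum>k\<in>UNIV. fun_scale (\<alpha> k) (sing_poly k))"
      using refl_group_imp_monomial unfolding span_sing_poly by blast
    show "act w u \<in> ?V"
      unfolding u w(2) act_sum act_scale act_monomial_map[OF w(1)]
      by (intro cfun.span_sum cfun.span_scale cfun.span_base) simp
  qed
  have "sing_poly undefined \<in> ?V"
    by (simp add: cfun.span_base)
  then show "?V \<noteq> {0}"
    using sing_poly_nonzero by blast
  fix U :: "(complex^'n \<Rightarrow> complex) set"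
  assume "cfun.subspace U \<and> stable (refl_group l) U \<and> U \<subseteq> ?V"
  then have sub: "cfun.subspace U" and "U \<subseteq> ?V"
    and stable: "\<And>w u. w \<in> refl_group l \<Longrightarrow> u \<in> U \<Longrightarrow> act w u \<in> U"
    by (auto simp: stable_def)
  have scale: "v \<in> U" if "fun_scale a v \<in> U" "a \<noteq> 0" for a v
  proof -
    have "fun_scale (inverse a) (fun_scale a v) \<in> U"
      using sub that(1) by (rule cfun.subspace_scale)
    then show ?thesis
      using that(2) by (simp add: fun_scale_def)
  qed
  show "U = {0} \<or> U = ?V"
  proof (rule disjCI)
    assume "U \<noteq> ?V"
    show "U = {0}"
    proof (rule ccontr)
      assume "U \<noteq> {0}"
      then obtain u where "u \<in> U" "u \<noteq> 0"
        using cfun.subspace_0[OF sub] by blast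
      then obtain \<alpha> where u: "u = (\<Sum>k\<in>UNIV. fun_scale (\<alpha> k) (sing_poly k))"
        using \<open>U \<subseteq> ?V\<close> unfolding span_sing_poly by blast
      then obtain j where j: "\<alpha> j \<noteq> 0"
        using \<open>u \<noteq> 0\<close> combination_eq_0_iff by blast
      have "rot l j \<in> refl_group l"
        using refl_group.rot[OF refl_group.id] by (metis comp_id)
      then have "isolate j u \<in> U"
        unfolding isolate_def using \<open>u \<in> U\<close> sub stable
        by (intro cfun.subspace_diff cfun.subspace_scale) auto
      then have fj: "sing_poly j \<in> U"
        using scale j eigen_gap_nonzero unfolding u isolate_combination by simp
      have "sing_poly k \<in> U" for k
      proof (cases "k = j")
        case False
        \<comment> \<open>With \<open>a = 0\<close> the reflection is a plain transposition and its
          scalar is 1.\<close>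
        have "sigma_refl l j k 0 \<in> refl_group l"
          using refl_group.sigma[OF refl_group.id, of j k 0] False l_pos by (metis comp_id)
        then have "act (sigma_refl l j k 0) (sing_poly j) \<in> U"
          using stable fj by blast
        then show ?thesis
          using act_sigma_refl[of j k 0 j] False by (simp add: fun_scale_def)
      qed (use fj in simp)
      then have "?V \<subseteq> U"
        using sub by (intro cfun.span_minimal) auto
      then show False
        using \<open>U \<subseteq> ?V\<close> \<open>U \<noteq> ?V\<close> by blast
    qed
  qed
qed

end

theorem proposition7:
  fixes l q m s :: nat and \<nu> :: complex and c :: "nat \<Rightarrow> complex"
  assumes "l \<ge> 2"
    and "1 \<le> q" and "q \<le> l - 1"
    and "\<nu> = of_nat m + (of_nat l - of_nat q + of_nat s) / of_nat l"
    and "c_ext l c (int q - int s) = 0"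
    and "c_ext l c (- int s) = of_nat s / of_nat l"
  shows "\<exists>f :: 'n::finite \<Rightarrow> complex^'n \<Rightarrow> complex.
    (\<forall>j x. (\<forall>i. x $ i \<noteq> 0) \<longrightarrow> f j x = residue_formula l \<nu> m q j x) \<and>
    (\<forall>j. homogeneous_polynomial ((CARD('n) - 1) * (m * l + l - q) + CARD('n) * s) (f j)) \<and>
    (\<forall>i j. dunkl_vanishes l \<nu> c i (f j)) \<and>
    irreducible_rep (refl_group l) (cfun.span (range f)) \<and>
    cfun.dim (cfun.span (range f)) = CARD('n)"
proof -
  interpret singular_parameters l q m s \<nu>
    by unfold_locales (fact assms(1-4))+
  show ?thesis
    using sing_poly_eq_residue_formula sing_poly_homogeneous dunkl_sing_poly[OF assms(5,6)]
      irreducible_span_sing_poly dim_span_sing_poly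
    by (intro exI[of _ sing_poly] conjI) auto
qed

end
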